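(* Up to equivalence there is a unique cell system on $\mathcal{E}_5^{(12)}$, given by $$W_{1,6,12}=W_{4,10,15}=W_{5,9,16}=\sqrt{[2][3]},\qquad W_{1,6,13}=W_{1,7,12}=[2]\sqrt{[3][4]},$$ $$W_{1,7,13}=W_{3,7,14}=W_{3,8,13}=W_{3,8,17}=W_{3,11,14}=W_{2,7,15}=W_{2,9,13}=W_{4,7,14}=W_{5,8,13}=\frac{[4]\sqrt{[3]}}{\sqrt{[2]}},$$ $$W_{1,8,14}=\frac{[4]\sqrt{[3][6]}}{\sqrt{[2]}},\qquad W_{1,7,14}=W_{1,8,13}=\frac{\sqrt{[3][4][6]}}{\sqrt{[2]}},$$ $$W_{2,6,12}=[4]\sqrt{[2]},\qquad W_{2,6,13}=W_{2,7,12}=[2]\sqrt{[4]},$$ $$W_{2,7,13}=-[4]\sqrt{[2]},\qquad W_{3,7,13}=-[4]\sqrt{[6]},$$ $$W_{3,8,14}=\frac{[4]\sqrt{[6]}}{[2]},\qquad W_{4,7,15}=W_{5,9,13}=\sqrt{[3][4]}.$$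
   Context: Let $q=e^{\pi i/12}$ and $[m]=(q^m-q^{-m})/(q-q^{-1})$. The graph $\mathcal{E}_5^{(12)}$ has vertices $1,\ldots,17$ and exactly the following edges (one each): $1\to 6,7,8$; $2\to 6,7,9$; $3\to 7,8,11$; $4\to 7,10$; $5\to 8,9$; $6\to 12,13$; $7\to 12,13,14,15$; $8\to 13,14,17$; $9\to 13,16$; $10\to 15$; $11\to 14$; $12\to 1,2$; $13\to 1,2,3,5$; $14\to 1,3,4$; $15\to 2,4$; $16\to 5$; $17\to 3$. Its Perron-Frobenius eigenvector (eigenvalue $[3]$) is $\phi_1=[3][6]/[2]$, $\phi_2=\phi_3=\phi_8=\phi_{14}=[3][4]/[2]$, $\phi_4=\phi_5=\phi_9=\phi_{15}=[3]$, $\phi_6=\phi_{12}=[2][3]^2/[6]=[2]^2$, $\phi_7=\phi_{13}=[3]^2[4]/[6]=[2][4]$, $\phi_{10}=\phi_{16}=1$, $\phi_{11}=\phi_{17}=[4]/[2]$. $W_{a,b,c}$ denotes the value of $W$ on the triangle $a\to b\to c\to a$. Cell systems: let $\mathcal{G}$ be a directed graph (loops and multiple edges allowed), with source and range maps $s,r$, Perron-Frobenius eigenvalue $[3]$ and positive Perron-Frobenius eigenvector $(\phi_i)$. A triangle $\triangle_{ijk}^{(\alpha\beta\gamma)}$ is a closed path $i\xrightarrow{\alpha}j\xrightarrow{\beta}k\xrightarrow{\gamma}i$, considered up to cyclic rotation. A cell system $W$ assigns to each triangle a complex number $W(\triangle_{ijk}^{(\alpha\beta\gamma)})$ such that: (I)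 for all edges $\alpha,\alpha'$ from $i$ to $j$, $\sum_{k,\beta,\gamma}W(\triangle_{ijk}^{(\alpha\beta\gamma)})\overline{W(\triangle_{ijk}^{(\alpha'\beta\gamma)})}=\delta_{\alpha,\alpha'}[2]\phi_i\phi_j$, the sum being over vertices $k$ and edges $\beta:j\to k$, $\gamma:k\to i$; (II) for all edges $\alpha_1,\dots,\alpha_4$ with $s(\alpha_1)=s(\alpha_4)=i_1$, $r(\alpha_1)=r(\alpha_2)=i_2$, $s(\alpha_2)=s(\alpha_3)=i_3$, $r(\alpha_3)=r(\alpha_4)=i_4$, $$\sum\phi_k^{-1}W(\triangle_{i_1i_2k}^{(\alpha_1\beta_1\beta_2)})\overline{W(\triangle_{i_3i_2k}^{(\alpha_2\beta_1\beta_3)})}W(\triangle_{i_3i_4k}^{(\alpha_3\beta_4\beta_3)})\overline{W(\triangle_{i_1i_4k}^{(\alpha_4\beta_4\beta_2)})}=\delta_{\alpha_1,\alpha_4}\delta_{\alpha_2,\alpha_3}\phi_{i_1}\phi_{i_2}\phi_{i_3}+\delta_{\alpha_1,\alpha_2}\delta_{\alpha_3,\alpha_4}\phi_{i_1}\phi_{i_2}\phi_{i_4},$$ the sum being over vertices $k$ and edges $\beta_1:i_2\to k$, $\beta_2:k\to i_1$, $\beta_3:k\to i_3$, $\beta_4:i_4\to k$. Two cell systems $W_1,W_2$ on $\mathcal{G}$ are equivalent if for each pair of adjacent vertices $i,j$ there is a unitary matrix $(u(\sigma,\sigma'))$ indexed by the edges from $i$ to $j$ such that for every triangle $W_1(\triangle_{ijk}^{(\sigma\rho\gamma)})=\sum_{\sigma',\rho',\gamma'}u(\sigma,\sigma')u(\rho,\rho')u(\gamma,\gamma')W_2(\triangle_{ijk}^{(\sigma'\rho'\gamma')})$,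 summing over edges $\sigma':i\to j$, $\rho':j\to k$, $\gamma':k\to i$.
   Formalization: Five printed values contradict condition (I) and are corrected: W_{2,7,15}=W_{2,9,13}=W_{4,7,14}=W_{5,8,13} is [3]√[4] instead of [4]√[3]/√[2], and W_{1,8,14} is [4]√([3][6])/[2] instead of [4]√([3][6])/√[2]. *)

theory Defs
  imports "HOL-Analysis.Analysis" "Graph_Theory.Digraph"
begin

section \<open>Quantum integers\<close>

definition q :: complex where
  "q = exp (\<i> * complex_of_real pi / 12)"

text \<open>The quotient defining \<open>[m]\<close> is a real number (see \<open>of_real_qint\<close>); \<open>Re\<close> only changes the
  type, so that square roots of quantum integers are the usual nonnegative real ones.\<close>

definition qint :: "nat \<Rightarrow> real" (\<open>qint[_]\<close>) where
  "qint[m] = Re ((q ^ m - inverse q ^ m) / (q - inverse q))"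

lemma q_power_diff: "q ^ m - inverse q ^ m = 2 * \<i> * complex_of_real (sin (real m * pi / 12))"
proof -
  have q: "q = cis (pi / 12)"
    by (simp add: q_def cis_conv_exp)
  have "q ^ m = cis (real m * pi / 12)" "inverse q ^ m = cis (- (real m * pi / 12))"
    unfolding q by (simp_all only: cis_inverse Complex.DeMoivre mult_minus_right times_divide_eq_right)
  then show ?thesis
    by (simp add: complex_eq_iff)
qed

lemma qint_sin: "qint[m] = sin (real m * pi / 12) / sin (pi / 12)"
  and of_real_qint: "complex_of_real (qint[m]) = (q ^ m - inverse q ^ m) / (q - inverse q)"
proof -
  have "q - inverse q = 2 * \<i> * complex_of_real (sin (pi / 12))"
    using q_power_diff[of 1] by simp
  then have *: "(q ^ m - inverse q ^ m) / (q - inverse q)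
      = complex_of_real (sin (real m * pi / 12) / sin (pi / 12))"
    by (simp add: q_power_diff)
  show "qint[m] = sin (real m * pi / 12) / sin (pi / 12)"
    unfolding qint_def * by simp
  show "complex_of_real (qint[m]) = (q ^ m - inverse q ^ m) / (q - inverse q)"
    unfolding qint_def * by simp
qed


section \<open>Cell systems\<close>

text \<open>An eigenvector of a nonnegative matrix with strictly positive entries belongs to the spectral
  radius, so the two assumptions say that \<open>[3]\<close> is the Perron-Frobenius eigenvalue of the adjacency
  matrix and \<open>\<phi>\<close> a Perron-Frobenius eigenvector. Loops and parallel arcs are allowed. The normalization
  of \<open>\<phi>\<close> is part of the data: the defining equations of a cell system depend on it.\<close>

locale pf_digraph = fin_digraph G for G :: "('v, 'e) pre_digraph" +
  fixes \<phi> :: "'v \<Rightarrow> real"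
  assumes \<phi>_pos: "i \<in> verts G \<Longrightarrow> \<phi> i > 0"
    and \<phi>_eigen: "i \<in> verts G \<Longrightarrow> (\<Sum>\<alpha> | \<alpha> \<in> arcs G \<and> tail G \<alpha> = i. \<phi> (head G \<alpha>)) = qint[3] * \<phi> i"
begin

definition arcs_betw :: "'v \<Rightarrow> 'v \<Rightarrow> 'e set" where
  "arcs_betw i j = {\<alpha> \<in> arcs G. tail G \<alpha> = i \<and> head G \<alpha> = j}"

definition triangles :: "('e \<times> 'e \<times> 'e) set" where
  "triangles = {(\<alpha>, \<beta>, \<gamma>). \<alpha> \<in> arcs G \<and> \<beta> \<in> arcs G \<and> \<gamma> \<in> arcs G \<and>
     head G \<alpha> = tail G \<beta> \<and> head G \<beta> = tail G \<gamma> \<and> head G \<gamma> = tail G \<alpha>}"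

text \<open>Triangles are taken up to cyclic rotation, so a function on triangles is a rotation-invariant
  function of three consecutive arcs. Its values outside \<^term>\<open>triangles\<close> are irrelevant.\<close>

definition rotation_invariant :: "('e \<Rightarrow> 'e \<Rightarrow> 'e \<Rightarrow> complex) \<Rightarrow> bool" where
  "rotation_invariant W \<longleftrightarrow> (\<forall>(\<alpha>, \<beta>, \<gamma>) \<in> triangles. W \<alpha> \<beta> \<gamma> = W \<beta> \<gamma> \<alpha>)"

definition type_I :: "('e \<Rightarrow> 'e \<Rightarrow> 'e \<Rightarrow> complex) \<Rightarrow> bool" where
  "type_I W \<longleftrightarrow>
     (\<forall>i \<in> verts G. \<forall>j \<in> verts G. \<forall>\<alpha> \<in> arcs_betw i j. \<forall>\<alpha>' \<in> arcs_betw i j.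
        (\<Sum>(\<beta>, \<gamma>) \<in> {(\<beta>, \<gamma>). (\<alpha>, \<beta>, \<gamma>) \<in> triangles}. W \<alpha> \<beta> \<gamma> * cnj (W \<alpha>' \<beta> \<gamma>))
        = complex_of_real (if \<alpha> = \<alpha>' then qint[2] * \<phi> i * \<phi> j else 0))"

text \<open>In the sum below the fourth vertex \<open>k\<close> is \<^term>\<open>head G \<beta>\<^sub>1\<close>; the four triangle conditions say
  \<open>\<beta>\<^sub>1 : i\<^sub>2 \<rightarrow> k\<close>, \<open>\<beta>\<^sub>2 : k \<rightarrow> i\<^sub>1\<close>, \<open>\<beta>\<^sub>3 : k \<rightarrow> i\<^sub>3\<close> and \<open>\<beta>\<^sub>4 : i\<^sub>4 \<rightarrow> k\<close>.\<close>

definition type_II :: "('e \<Rightarrow> 'e \<Rightarrow> 'e \<Rightarrow> complex) \<Rightarrow> bool" where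
  "type_II W \<longleftrightarrow>
     (\<forall>i\<^sub>1 \<in> verts G. \<forall>i\<^sub>2 \<in> verts G. \<forall>i\<^sub>3 \<in> verts G. \<forall>i\<^sub>4 \<in> verts G.
      \<forall>\<alpha>\<^sub>1 \<in> arcs_betw i\<^sub>1 i\<^sub>2. \<forall>\<alpha>\<^sub>2 \<in> arcs_betw i\<^sub>3 i\<^sub>2. \<forall>\<alpha>\<^sub>3 \<in> arcs_betw i\<^sub>3 i\<^sub>4. \<forall>\<alpha>\<^sub>4 \<in> arcs_betw i\<^sub>1 i\<^sub>4.
        (\<Sum>(\<beta>\<^sub>1, \<beta>\<^sub>2, \<beta>\<^sub>3, \<beta>\<^sub>4) \<in> {(\<beta>\<^sub>1, \<beta>\<^sub>2, \<beta>\<^sub>3, \<beta>\<^sub>4).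
             (\<alpha>\<^sub>1, \<beta>\<^sub>1, \<beta>\<^sub>2) \<in> triangles \<and> (\<alpha>\<^sub>2, \<beta>\<^sub>1, \<beta>\<^sub>3) \<in> triangles \<and>
             (\<alpha>\<^sub>3, \<beta>\<^sub>4, \<beta>\<^sub>3) \<in> triangles \<and> (\<alpha>\<^sub>4, \<beta>\<^sub>4, \<beta>\<^sub>2) \<in> triangles}.
           complex_of_real (inverse (\<phi> (head G \<beta>\<^sub>1))) *
             (W \<alpha>\<^sub>1 \<beta>\<^sub>1 \<beta>\<^sub>2 * cnj (W \<alpha>\<^sub>2 \<beta>\<^sub>1 \<beta>\<^sub>3) * W \<alpha>\<^sub>3 \<beta>\<^sub>4 \<beta>\<^sub>3 * cnj (W \<alpha>\<^sub>4 \<beta>\<^sub>4 \<beta>\<^sub>2)))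
        = complex_of_real
            ((if \<alpha>\<^sub>1 = \<alpha>\<^sub>4 \<and> \<alpha>\<^sub>2 = \<alpha>\<^sub>3 then \<phi> i\<^sub>1 * \<phi> i\<^sub>2 * \<phi> i\<^sub>3 else 0) +
             (if \<alpha>\<^sub>1 = \<alpha>\<^sub>2 \<and> \<alpha>\<^sub>3 = \<alpha>\<^sub>4 then \<phi> i\<^sub>1 * \<phi> i\<^sub>2 * \<phi> i\<^sub>4 else 0)))"

definition cell_system :: "('e \<Rightarrow> 'e \<Rightarrow> 'e \<Rightarrow> complex) \<Rightarrow> bool" where
  "cell_system W \<longleftrightarrow> rotation_invariant W \<and> type_I W \<and> type_II W"

definition unitary_on :: "'e set \<Rightarrow> ('e \<Rightarrow> 'e \<Rightarrow> complex) \<Rightarrow> bool" where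
  "unitary_on A u \<longleftrightarrow>
     (\<forall>\<sigma> \<in> A. \<forall>\<sigma>' \<in> A. (\<Sum>\<tau> \<in> A. u \<sigma> \<tau> * cnj (u \<sigma>' \<tau>)) = (if \<sigma> = \<sigma>' then 1 else 0)) \<and>
     (\<forall>\<sigma> \<in> A. \<forall>\<sigma>' \<in> A. (\<Sum>\<tau> \<in> A. cnj (u \<tau> \<sigma>) * u \<tau> \<sigma>') = (if \<sigma> = \<sigma>' then 1 else 0))"

text \<open>An arc determines its endpoints, so one function \<open>u\<close> carries the unitary matrices of all pairs
  of adjacent vertices; entries at non-parallel arcs are never used.\<close>

definition equivalent :: "('e \<Rightarrow> 'e \<Rightarrow> 'e \<Rightarrow> complex) \<Rightarrow> ('e \<Rightarrow> 'e \<Rightarrow> 'e \<Rightarrow> complex) \<Rightarrow> bool" where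
  "equivalent W\<^sub>1 W\<^sub>2 \<longleftrightarrow>
     (\<exists>u. (\<forall>i \<in> verts G. \<forall>j \<in> verts G. unitary_on (arcs_betw i j) u) \<and>
       (\<forall>i \<in> verts G. \<forall>j \<in> verts G. \<forall>k \<in> verts G.
        \<forall>\<sigma> \<in> arcs_betw i j. \<forall>\<rho> \<in> arcs_betw j k. \<forall>\<gamma> \<in> arcs_betw k i.
          W\<^sub>1 \<sigma> \<rho> \<gamma> =
            (\<Sum>\<sigma>' \<in> arcs_betw i j. \<Sum>\<rho>' \<in> arcs_betw j k. \<Sum>\<gamma>' \<in> arcs_betw k i.
               u \<sigma> \<sigma>' * u \<rho> \<rho>' * u \<gamma> \<gamma>' * W\<^sub>2 \<sigma>' \<rho>' \<gamma>')))"

end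


section \<open>The graph \<open>\<E>\<^sub>5\<close> at level 12\<close>

definition E5_arcs :: "(nat \<times> nat) set" where
  "E5_arcs = {
     (1, 6), (1, 7), (1, 8),  (2, 6), (2, 7), (2, 9),  (3, 7), (3, 8), (3, 11),
     (4, 7), (4, 10),  (5, 8), (5, 9),
     (6, 12), (6, 13),  (7, 12), (7, 13), (7, 14), (7, 15),  (8, 13), (8, 14), (8, 17),
     (9, 13), (9, 16),  (10, 15),  (11, 14),
     (12, 1), (12, 2),  (13, 1), (13, 2), (13, 3), (13, 5),  (14, 1), (14, 3), (14, 4),
     (15, 2), (15, 4),  (16, 5),  (17, 3)}"

definition E5 :: "(nat, nat \<times> nat) pre_digraph" where
  "E5 = \<lparr>verts = {1..17}, arcs = E5_arcs, tail = fst, head = snd\<rparr>"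

lemma E5_simps [simp]: "verts E5 = {1..17}" "arcs E5 = E5_arcs" "tail E5 = fst" "head E5 = snd"
  by (simp_all add: E5_def)

definition E5_phi :: "nat \<Rightarrow> real" where
  "E5_phi i =
     (if i = 1 then qint[3] * qint[6] / qint[2]
      else if i \<in> {2, 3, 8, 14} then qint[3] * qint[4] / qint[2]
      else if i \<in> {4, 5, 9, 15} then qint[3]
      else if i \<in> {6, 12} then (qint[2])\<^sup>2
      else if i \<in> {7, 13} then qint[2] * qint[4]
      else if i \<in> {10, 16} then 1
      else qint[4] / qint[2])"

lemma sin_pi_12_pos: "sin (pi / 12) > 0"
  by (rule sin_gt_zero) auto

lemma qint_pos: "0 < m \<Longrightarrow> m < 12 \<Longrightarrow> qint[m] > 0"
  unfolding qint_sin
  by (intro divide_pos_pos sin_pi_12_pos sin_gt_zero) (auto simp: field_simps)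

lemma qint_1: "qint[1] = 1"
  using sin_pi_12_pos by (simp add: qint_sin)

lemma qint_2_mult: "qint[2] * qint[Suc m] = qint[Suc (Suc m)] + qint[m]"
proof -
  have "sin (pi / 6) = 2 * sin (pi / 12) * cos (pi / 12)"
    using sin_double[of "pi / 12"] by simp
  then have "qint[2] = 2 * cos (pi / 12)"
    using sin_pi_12_pos by (simp add: qint_sin)
  moreover have "sin (real (Suc (Suc m)) * pi / 12) + sin (real m * pi / 12)
      = 2 * cos (pi / 12) * sin (real (Suc m) * pi / 12)"
  proof -
    have "real (Suc (Suc m)) * pi / 12 = real (Suc m) * pi / 12 + pi / 12"
      and "real m * pi / 12 = real (Suc m) * pi / 12 - pi / 12"
      by (simp_all add: field_simps)
    then show ?thesis
      by (simp only: sin_add sin_diff) (simp add: algebra_simps)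
  qed
  ultimately show ?thesis
    by (simp add: qint_sin add_divide_distrib [symmetric])
qed

lemma qint_6: "qint[6] = 2 * qint[2]"
proof -
  have "sin (6 * pi / 12) = (1::real)" "sin (2 * pi / 12) = (1 / 2 :: real)"
    using sin_30 by simp_all
  then show ?thesis by (simp add: qint_sin)
qed

lemma qint_relations:
  shows "(qint[2])\<^sup>2 = qint[3] + 1"
    and "qint[2] * qint[3] = qint[4] + qint[2]"
    and "(qint[3])\<^sup>2 = 2 * qint[3] + 2"
proof -
  have 0: "qint[0] = 0" by (simp add: qint_sin)
  have 3: "qint[2] * qint[2] = qint[3] + 1"
    using qint_2_mult[of 1] by (simp add: numeral_eq_Suc qint_1[simplified])
  have 4: "qint[2] * qint[3] = qint[4] + qint[2]"
    using qint_2_mult[of 2] by (simp add: numeral_eq_Suc)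
  have 5: "qint[2] * qint[4] = qint[5] + qint[3]"
    using qint_2_mult[of 3] by (simp add: numeral_eq_Suc)
  have 6: "qint[2] * qint[5] = qint[6] + qint[4]"
    using qint_2_mult[of 4] by (simp add: numeral_eq_Suc)
  show "(qint[2])\<^sup>2 = qint[3] + 1" using 3 by (simp add: power2_eq_square)
  show "qint[2] * qint[3] = qint[4] + qint[2]" by (fact 4)
  define a where "a = qint[2]"
  have a: "a > 0" unfolding a_def by (rule qint_pos) auto
  have c3: "qint[3] = a * a - 1" using 3 by (simp add: a_def)
  have c4: "qint[4] = a * (a * a - 1) - a" using 4 c3 by (simp add: a_def)
  have c5: "qint[5] = a * (a * (a * a - 1) - a) - (a * a - 1)" using 5 c3 c4 by (simp add: a_def)
  have "a * qint[5] = 2 * a + qint[4]" using 6 qint_6 by (simp add: a_def)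
  then have "a * (a * (a * (a * a - 1) - a) - (a * a - 1) - 2 - (a * a - 1) + 1) = 0"
    unfolding c4 c5 by (simp add: algebra_simps)
  then have "a * (a * (a * a - 1) - a) - (a * a - 1) - 2 - (a * a - 1) + 1 = 0"
    using a by simp
  then show "(qint[3])\<^sup>2 = 2 * qint[3] + 2"
    unfolding c3 by (simp add: algebra_simps power2_eq_square)
qed

lemma E5_phi_alternative:
  shows "qint[2] * (qint[3])\<^sup>2 / qint[6] = (qint[2])\<^sup>2"
    and "(qint[3])\<^sup>2 * qint[4] / qint[6] = qint[2] * qint[4]"
proof -
  have a: "qint[2] > 0" by (rule qint_pos) auto
  have "(qint[3])\<^sup>2 = 2 * (qint[2])\<^sup>2" using qint_relations by simp
  then show "qint[2] * (qint[3])\<^sup>2 / qint[6] = (qint[2])\<^sup>2"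
    "(qint[3])\<^sup>2 * qint[4] / qint[6] = qint[2] * qint[4]"
    using a by (simp_all add: qint_6 power2_eq_square field_simps)
qed

lemma E5_phi_linear:
  "E5_phi i =
     (if i = 1 then 2 * qint[3]
      else if i \<in> {2, 3, 8, 14} then qint[3] + 2
      else if i \<in> {4, 5, 9, 15} then qint[3]
      else if i \<in> {6, 12} then qint[3] + 1
      else if i \<in> {7, 13} then 2 * qint[3] + 1
      else if i \<in> {10, 16} then 1
      else qint[3] - 1)"
proof -
  have "qint[2] > 0" by (rule qint_pos) auto
  then have 42: "qint[4] / qint[2] = qint[3] - 1"
    using qint_relations(2) by (simp add: field_simps)
  have "qint[3] * qint[6] / qint[2] = 2 * qint[3]"
    using \<open>qint[2] > 0\<close> by (simp add: qint_6)
  moreover have "qint[3] * qint[4] / qint[2] = qint[3] + 2"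
    using qint_relations(3)
    by (simp only: 42 times_divide_eq_right [symmetric]) (simp add: algebra_simps power2_eq_square)
  moreover have "qint[2] * qint[4] = (qint[2])\<^sup>2 * (qint[4] / qint[2])"
    using \<open>qint[2] > 0\<close> by (simp add: power2_eq_square)
  then have "qint[2] * qint[4] = 2 * qint[3] + 1"
    using qint_relations(3)
    by (simp only: 42 qint_relations(1)) (simp add: algebra_simps power2_eq_square)
  ultimately show ?thesis
    unfolding E5_phi_def by (simp add: 42 qint_relations(1))
qed

interpretation E5: pf_digraph E5 E5_phi
proof
  show "e \<in> arcs E5 \<Longrightarrow> tail E5 e \<in> verts E5" for e
    by (auto simp: E5_arcs_def)
  show "e \<in> arcs E5 \<Longrightarrow> head E5 e \<in> verts E5" for e
    by (auto simp: E5_arcs_def)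
  show "finite (verts E5)" "finite (arcs E5)"
    by (simp_all add: E5_arcs_def)
  show "E5_phi i > 0" for i
    unfolding E5_phi_def using qint_pos[of 2] qint_pos[of 3] qint_pos[of 4] qint_pos[of 6] by auto
next
  fix i assume "i \<in> verts E5"
  then have "i \<in> {1, 2, 3, 4, 5, 6, 7, 8, 9, 10, 11, 12, 13, 14, 15, 16, 17}"
    by (auto simp: numeral_eq_Suc le_Suc_eq)
  moreover have "(\<Sum>\<alpha> | \<alpha> \<in> arcs E5 \<and> tail E5 \<alpha> = i. E5_phi (head E5 \<alpha>))
      = (\<Sum>\<alpha> \<in> E5_arcs. if fst \<alpha> = i then E5_phi (snd \<alpha>) else 0)"
    by (simp add: sum.inter_filter [symmetric] E5_arcs_def)
  moreover have "qint[3] * qint[3] = 2 * qint[3] + 2"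
    using qint_relations(3) by (simp add: power2_eq_square)
  ultimately show "(\<Sum>\<alpha> | \<alpha> \<in> arcs E5 \<and> tail E5 \<alpha> = i. E5_phi (head E5 \<alpha>)) = qint[3] * E5_phi i"
    by (elim insertE emptyE) (simp_all add: E5_arcs_def E5_phi_linear algebra_simps)
qed

text \<open>The value on the triangle \<open>a \<rightarrow> b \<rightarrow> c \<rightarrow> a\<close>.\<close>

abbreviation cell :: "(nat \<times> nat \<Rightarrow> nat \<times> nat \<Rightarrow> nat \<times> nat \<Rightarrow> complex) \<Rightarrow> nat \<Rightarrow> nat \<Rightarrow> nat \<Rightarrow> complex" where
  "cell W a b c \<equiv> W (a, b) (b, c) (c, a)"

lemma E5_type_I_edge:
  assumes "E5.type_I W" "(a, b) \<in> E5_arcs"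
  shows "(\<Sum>c | (b, c) \<in> E5_arcs \<and> (c, a) \<in> E5_arcs. (cmod (cell W a b c))\<^sup>2) = qint[2] * E5_phi a * E5_phi b"
proof -
  let ?C = "{c. (b, c) \<in> E5_arcs \<and> (c, a) \<in> E5_arcs}"
  have "a \<in> verts E5" "b \<in> verts E5" "(a, b) \<in> E5.arcs_betw a b"
    using assms(2) by (auto simp: E5.arcs_betw_def E5_arcs_def)
  then have "complex_of_real (qint[2] * E5_phi a * E5_phi b)
      = (\<Sum>(\<beta>, \<gamma>) \<in> {(\<beta>, \<gamma>). ((a, b), \<beta>, \<gamma>) \<in> E5.triangles}. W (a, b) \<beta> \<gamma> * cnj (W (a, b) \<beta> \<gamma>))"
    using assms(1) unfolding E5.type_I_def by force
  also have "{(\<beta>, \<gamma>). ((a, b), \<beta>, \<gamma>) \<in> E5.triangles} = (\<lambda>c. ((b, c), (c, a))) ` ?C"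
    using assms(2) by (auto simp: E5.triangles_def)
  also have "(\<Sum>(\<beta>, \<gamma>) \<in> (\<lambda>c. ((b, c), (c, a))) ` ?C. W (a, b) \<beta> \<gamma> * cnj (W (a, b) \<beta> \<gamma>))
      = (\<Sum>c \<in> ?C. cell W a b c * cnj (cell W a b c))"
    by (subst sum.reindex) (auto simp: inj_on_def)
  also have "\<dots> = complex_of_real (\<Sum>c \<in> ?C. (cmod (cell W a b c))\<^sup>2)"
    by (simp only: of_real_sum complex_norm_square)
  finally show ?thesis
    by (simp only: of_real_eq_iff)
qed

text \<open>Condition (I) alone forces the following moduli. Hence the source's formulas
  \<open>[4] \<surd>[3] / \<surd>[2]\<close> for the cells \<open>(2,7,15)\<close>, \<open>(2,9,13)\<close>, \<open>(4,7,14)\<close>, \<open>(5,8,13)\<close> and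
  \<open>[4] \<surd>([3][6]) / \<surd>[2]\<close> for the cell \<open>(1,8,14)\<close>, given its value on \<open>(1,8,13)\<close>, are misprints of
  \<open>[3] \<surd>[4]\<close> and \<open>[4] \<surd>([3][6]) / [2]\<close> respectively.\<close>

lemma E5_forced_moduli:
  assumes "E5.cell_system W"
  shows "(cmod (cell W 2 9 13))\<^sup>2 = (qint[3])\<^sup>2 * qint[4]"
    and "(cmod (cell W 5 8 13))\<^sup>2 = (qint[3])\<^sup>2 * qint[4]"
    and "(cmod (cell W 2 7 15))\<^sup>2 = (qint[3])\<^sup>2 * qint[4]"
    and "(cmod (cell W 4 7 14))\<^sup>2 = (qint[3])\<^sup>2 * qint[4]"
    and "(cmod (cell W 1 8 13))\<^sup>2 = qint[3] * qint[4] * qint[6] / qint[2] \<Longrightarrow>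
         (cmod (cell W 1 8 14))\<^sup>2 = (qint[4])\<^sup>2 * qint[3] * qint[6] / (qint[2])\<^sup>2"
proof -
  note I = E5_type_I_edge[OF assms[unfolded E5.cell_system_def, THEN conjunct2, THEN conjunct1]]
  have 2: "qint[2] > 0" by (rule qint_pos) auto
  have rot: "W \<beta> \<gamma> \<alpha> = W \<alpha> \<beta> \<gamma>" if "(\<alpha>, \<beta>, \<gamma>) \<in> E5.triangles" for \<alpha> \<beta> \<gamma>
    using assms that unfolding E5.cell_system_def E5.rotation_invariant_def by auto
  have "{c. (9, c) \<in> E5_arcs \<and> (c, 2) \<in> E5_arcs} = {13}"
    and "{c. (8, c) \<in> E5_arcs \<and> (c, 5) \<in> E5_arcs} = {13}"
    and "{c. (2, c) \<in> E5_arcs \<and> (c, 15) \<in> E5_arcs} = {7}"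
    and "{c. (4, c) \<in> E5_arcs \<and> (c, 14) \<in> E5_arcs} = {7}"
    and "{c. (8, c) \<in> E5_arcs \<and> (c, 1) \<in> E5_arcs} = {13, 14}"
    by (auto simp: E5_arcs_def)
  note C = this
  have "cell W 15 2 7 = cell W 2 7 15" "cell W 14 4 7 = cell W 4 7 14"
    by (rule rot [symmetric], simp add: E5.triangles_def E5_arcs_def)+
  note R = this
  have e: "E5_phi 2 = qint[3] * qint[4] / qint[2]" "E5_phi 9 = qint[3]"
    "E5_phi 5 = qint[3]" "E5_phi 8 = qint[3] * qint[4] / qint[2]"
    "E5_phi 15 = qint[3]" "E5_phi 4 = qint[3]" "E5_phi 14 = qint[3] * qint[4] / qint[2]"
    "E5_phi 1 = qint[3] * qint[6] / qint[2]"
    by (simp_all add: E5_phi_def)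
  show "(cmod (cell W 2 9 13))\<^sup>2 = (qint[3])\<^sup>2 * qint[4]"
    using I[of 2 9] 2 unfolding C e by (simp add: E5_arcs_def power2_eq_square)
  show "(cmod (cell W 5 8 13))\<^sup>2 = (qint[3])\<^sup>2 * qint[4]"
    using I[of 5 8] 2 unfolding C e by (simp add: E5_arcs_def power2_eq_square)
  show "(cmod (cell W 2 7 15))\<^sup>2 = (qint[3])\<^sup>2 * qint[4]"
    using I[of 15 2] 2 unfolding C e by (simp add: E5_arcs_def power2_eq_square R)
  show "(cmod (cell W 4 7 14))\<^sup>2 = (qint[3])\<^sup>2 * qint[4]"
    using I[of 14 4] 2 unfolding C e by (simp add: E5_arcs_def power2_eq_square R)
  assume "(cmod (cell W 1 8 13))\<^sup>2 = qint[3] * qint[4] * qint[6] / qint[2]"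
  then have "(cmod (cell W 1 8 14))\<^sup>2
      = qint[2] * (qint[3] * qint[6] / qint[2]) * (qint[3] * qint[4] / qint[2]) - qint[3] * qint[4] * qint[6] / qint[2]"
    using I[of 1 8] unfolding C e by (simp add: E5_arcs_def)
  also have "\<dots> = (qint[4])\<^sup>2 * qint[3] * qint[6] / (qint[2])\<^sup>2"
  proof -
    have 4: "qint[4] = qint[2] * (qint[3] - 1)"
      using qint_relations(2) by (simp add: algebra_simps)
    show ?thesis
      unfolding 4 using 2 by (simp add: field_simps power2_eq_square)
  qed
  finally show "(cmod (cell W 1 8 14))\<^sup>2 = (qint[4])\<^sup>2 * qint[3] * qint[6] / (qint[2])\<^sup>2" .
qed

lemma E5_misprints:
  shows "(qint[4] * sqrt (qint[3]) / sqrt (qint[2]))\<^sup>2 \<noteq> (qint[3])\<^sup>2 * qint[4]"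
    and "(qint[4] * sqrt (qint[3] * qint[6]) / sqrt (qint[2]))\<^sup>2
           \<noteq> (qint[4])\<^sup>2 * qint[3] * qint[6] / (qint[2])\<^sup>2"
proof -
  have pos: "qint[2] > 0" "qint[3] > 0" "qint[4] > 0" "qint[6] > 0"
    by (rule qint_pos; simp)+
  have "qint[4] \<noteq> qint[2] * qint[3]" "qint[2] \<noteq> 1"
    using pos qint_relations(1,2) by auto
  with pos show "(qint[4] * sqrt (qint[3]) / sqrt (qint[2]))\<^sup>2 \<noteq> (qint[3])\<^sup>2 * qint[4]"
    and "(qint[4] * sqrt (qint[3] * qint[6]) / sqrt (qint[2]))\<^sup>2
           \<noteq> (qint[4])\<^sup>2 * qint[3] * qint[6] / (qint[2])\<^sup>2"
    by (simp_all add: field_simps power2_eq_square)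
qed

end

theory Submission
  imports Defs
begin

text \<open>
  As the graph has no parallel arcs, a cell system is a family of complex numbers on the 25 triangles
  (up to rotation), condition (II) is indexed by closed walks \<open>a \<rightarrow> b \<leftarrow> c \<rightarrow> d \<leftarrow> a\<close>
  (\<open>E5_type_II_iff\<close>), and an equivalence is a choice of a phase for every arc. The walks with
  \<open>a = c\<close> or \<open>b = d\<close> only see the moduli of the cells. Each of the remaining ones gives
  two of the three factors of one of the cubes \<open>{1, 2} \<times> {6, 7} \<times> {12, 13}\<close> and
  \<open>{1, 3} \<times> {7, 8} \<times> {13, 14}\<close>, whose corners are triangles; the sum in condition (II) then has two
  summands, which belong to opposite faces of the cube. The cubes share the corner \<open>(1, 7, 13)\<close>.

  Uniqueness. The moduli are forced (\<open>E5_equal_norms\<close>): condition (I) is linear in the squared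
  moduli, and its two-dimensional solution space, with one degree of freedom for each cube, is cut down
  to a point by two instances of condition (II) with only one summand. Hence two cell systems differ by
  phases \<open>\<theta>\<close> on the triangles. Condition (II) says that the summands of opposite faces
  of a cube cancel, which fixes their relative phase; so the alternating product of \<open>\<theta>\<close> over the
  corners of each cube is 1 (\<open>E5_cube\<close>). These two relations are the only obstruction to writing
  \<open>\<theta>\<close> as a product of phases of arcs (\<open>E5_gauge\<close>), and the latter is an equivalence
  (\<open>E5_equivalent\<close>).

  Existence. Take \<open>W = \<plusminus> \<surd>([2] x)\<close> with weights \<open>x\<close> in \<open>\<int>[[3]]\<close> and with the minus sign at one corner
  of each cube, not their common one. Since \<open>\<phi>\<close> is also linear in \<open>[3]\<close>, condition (I) and the
  degenerate part of condition (II) become identities modulo \<open>[3]\<^sup>2 = 2 [3] + 2\<close>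
  (\<open>E5_weight_type_I\<close>, \<open>E5_weight_out\<close>, \<open>E5_weight_in\<close>). The summands of opposite faces of a cube
  have the same absolute value, and opposite signs because exactly one of the eight corners of the cube
  is negative (\<open>E5_value_cycle\<close>).
\<close>


section \<open>The triangles of the graph\<close>

text \<open>Vertices are numerals: the simplifier must not turn the vertex \<open>1\<close> into \<open>Suc 0\<close>.\<close>

declare One_nat_def [simp del]

lemma E5_out:
  "(1, k) \<in> E5_arcs \<longleftrightarrow> k = 6 \<or> k = 7 \<or> k = 8"
  "(2, k) \<in> E5_arcs \<longleftrightarrow> k = 6 \<or> k = 7 \<or> k = 9"
  "(3, k) \<in> E5_arcs \<longleftrightarrow> k = 7 \<or> k = 8 \<or> k = 11"
  "(4, k) \<in> E5_arcs \<longleftrightarrow> k = 7 \<or> k = 10"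
  "(5, k) \<in> E5_arcs \<longleftrightarrow> k = 8 \<or> k = 9"
  "(6, k) \<in> E5_arcs \<longleftrightarrow> k = 12 \<or> k = 13"
  "(7, k) \<in> E5_arcs \<longleftrightarrow> k = 12 \<or> k = 13 \<or> k = 14 \<or> k = 15"
  "(8, k) \<in> E5_arcs \<longleftrightarrow> k = 13 \<or> k = 14 \<or> k = 17"
  "(9, k) \<in> E5_arcs \<longleftrightarrow> k = 13 \<or> k = 16"
  "(10, k) \<in> E5_arcs \<longleftrightarrow> k = 15"
  "(11, k) \<in> E5_arcs \<longleftrightarrow> k = 14"
  "(12, k) \<in> E5_arcs \<longleftrightarrow> k = 1 \<or> k = 2"
  "(13, k) \<in> E5_arcs \<longleftrightarrow> k = 1 \<or> k = 2 \<or> k = 3 \<or> k = 5"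
  "(14, k) \<in> E5_arcs \<longleftrightarrow> k = 1 \<or> k = 3 \<or> k = 4"
  "(15, k) \<in> E5_arcs \<longleftrightarrow> k = 2 \<or> k = 4"
  "(16, k) \<in> E5_arcs \<longleftrightarrow> k = 5"
  "(17, k) \<in> E5_arcs \<longleftrightarrow> k = 3"
  by (auto simp: E5_arcs_def)

lemma E5_in:
  "(k, 1) \<in> E5_arcs \<longleftrightarrow> k = 12 \<or> k = 13 \<or> k = 14"
  "(k, 2) \<in> E5_arcs \<longleftrightarrow> k = 12 \<or> k = 13 \<or> k = 15"
  "(k, 3) \<in> E5_arcs \<longleftrightarrow> k = 13 \<or> k = 14 \<or> k = 17"
  "(k, 4) \<in> E5_arcs \<longleftrightarrow> k = 14 \<or> k = 15"
  "(k, 5) \<in> E5_arcs \<longleftrightarrow> k = 13 \<or> k = 16"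
  "(k, 6) \<in> E5_arcs \<longleftrightarrow> k = 1 \<or> k = 2"
  "(k, 7) \<in> E5_arcs \<longleftrightarrow> k = 1 \<or> k = 2 \<or> k = 3 \<or> k = 4"
  "(k, 8) \<in> E5_arcs \<longleftrightarrow> k = 1 \<or> k = 3 \<or> k = 5"
  "(k, 9) \<in> E5_arcs \<longleftrightarrow> k = 2 \<or> k = 5"
  "(k, 10) \<in> E5_arcs \<longleftrightarrow> k = 4"
  "(k, 11) \<in> E5_arcs \<longleftrightarrow> k = 3"
  "(k, 12) \<in> E5_arcs \<longleftrightarrow> k = 6 \<or> k = 7"
  "(k, 13) \<in> E5_arcs \<longleftrightarrow> k = 6 \<or> k = 7 \<or> k = 8 \<or> k = 9"
  "(k, 14) \<in> E5_arcs \<longleftrightarrow> k = 7 \<or> k = 8 \<or> k = 11"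
  "(k, 15) \<in> E5_arcs \<longleftrightarrow> k = 7 \<or> k = 10"
  "(k, 16) \<in> E5_arcs \<longleftrightarrow> k = 9"
  "(k, 17) \<in> E5_arcs \<longleftrightarrow> k = 8"
  by (auto simp: E5_arcs_def)

lemmas E5_eval = E5_out conj_disj_distribR Collect_disj_eq Collect_conv_if

text \<open>One representative of each rotation class. The graph is tripartite, with classes \<open>{1..5}\<close>,
  \<open>{6..11}\<close> and \<open>{12..17}\<close> passed in this cyclic order, so every triangle has exactly one vertex
  in \<open>{1..5}\<close>, and the representative starts there.\<close>

definition E5_cells :: "(nat \<times> nat \<times> nat) set" where
  "E5_cells = {
     (1, 6, 12), (1, 6, 13), (1, 7, 12), (1, 7, 13), (1, 7, 14), (1, 8, 13), (1, 8, 14),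
     (2, 6, 12), (2, 6, 13), (2, 7, 12), (2, 7, 13), (2, 7, 15), (2, 9, 13),
     (3, 7, 13), (3, 7, 14), (3, 8, 13), (3, 8, 14), (3, 8, 17), (3, 11, 14),
     (4, 7, 14), (4, 7, 15), (4, 10, 15), (5, 8, 13), (5, 9, 13), (5, 9, 16)}"

lemma E5_triangle_rotate:
  assumes "(a, b) \<in> E5_arcs" "(b, c) \<in> E5_arcs" "(c, a) \<in> E5_arcs"
  shows "(a, b, c) \<in> E5_cells \<or> (b, c, a) \<in> E5_cells \<or> (c, a, b) \<in> E5_cells"
proof -
  have "\<forall>(a, b) \<in> E5_arcs. \<forall>c. (b, c) \<in> E5_arcs \<longrightarrow> (c, a) \<in> E5_arcs \<longrightarrow>
      (a, b, c) \<in> E5_cells \<or> (b, c, a) \<in> E5_cells \<or> (c, a, b) \<in> E5_cells"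
    apply (subst (1) E5_arcs_def)
    apply (simp add: E5_out all_conj_distrib imp_disjL)
    apply (simp add: E5_cells_def)
    done
  with assms show ?thesis by blast
qed

lemma E5_triangle_induct [consumes 3, case_names cell rotate]:
  assumes "(a, b) \<in> E5_arcs" "(b, c) \<in> E5_arcs" "(c, a) \<in> E5_arcs"
    and "\<And>a b c. (a, b, c) \<in> E5_cells \<Longrightarrow> P a b c"
    and "\<And>a b c. (a, b) \<in> E5_arcs \<Longrightarrow> (b, c) \<in> E5_arcs \<Longrightarrow> (c, a) \<in> E5_arcs \<Longrightarrow> P a b c \<Longrightarrow> P b c a"
  shows "P a b c"
  using E5_triangle_rotate[OF assms(1-3)] assms by meson

lemma E5_cells_triangle:
  "(a, b, c) \<in> E5_cells \<Longrightarrow> (a, b) \<in> E5_arcs \<and> (b, c) \<in> E5_arcs \<and> (c, a) \<in> E5_arcs"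
proof -
  have "\<forall>(a, b, c) \<in> E5_cells. (a, b) \<in> E5_arcs \<and> (b, c) \<in> E5_arcs \<and> (c, a) \<in> E5_arcs"
    by (simp add: E5_cells_def E5_out)
  then show "(a, b, c) \<in> E5_cells \<Longrightarrow> (a, b) \<in> E5_arcs \<and> (b, c) \<in> E5_arcs \<and> (c, a) \<in> E5_arcs"
    by blast
qed

lemma E5_arcs_betw: "E5.arcs_betw a b = (if (a, b) \<in> E5_arcs then {(a, b)} else {})"
  by (auto simp: E5.arcs_betw_def)

lemma E5_verts: "(a, b) \<in> E5_arcs \<Longrightarrow> a \<in> {1..17} \<and> b \<in> {1..17}"
  by (auto simp: E5_arcs_def)


section \<open>The cell conditions in terms of vertices\<close>

lemma E5_rotation:
  assumes "E5.rotation_invariant W" "(a, b) \<in> E5_arcs" "(b, c) \<in> E5_arcs" "(c, a) \<in> E5_arcs"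
  shows "cell W b c a = cell W a b c"
  using assms unfolding E5.rotation_invariant_def by (fastforce simp: E5.triangles_def)

lemma E5_type_I_iff:
  "E5.type_I W \<longleftrightarrow> (\<forall>a b. (a, b) \<in> E5_arcs \<longrightarrow>
     (\<Sum>c | (b, c) \<in> E5_arcs \<and> (c, a) \<in> E5_arcs. (cmod (cell W a b c))\<^sup>2) = qint[2] * E5_phi a * E5_phi b)"
    (is "_ \<longleftrightarrow> ?R")
proof
  show ?R if "E5.type_I W" using E5_type_I_edge[OF that] by blast
next
  assume R: ?R
  have "(\<Sum>(\<beta>, \<gamma>) \<in> {(\<beta>, \<gamma>). ((a, b), \<beta>, \<gamma>) \<in> E5.triangles}. W (a, b) \<beta> \<gamma> * cnj (W (a, b) \<beta> \<gamma>))
      = complex_of_real (qint[2] * E5_phi a * E5_phi b)" if "(a, b) \<in> E5_arcs" for a b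
  proof -
    let ?C = "{c. (b, c) \<in> E5_arcs \<and> (c, a) \<in> E5_arcs}"
    have "{(\<beta>, \<gamma>). ((a, b), \<beta>, \<gamma>) \<in> E5.triangles} = (\<lambda>c. ((b, c), (c, a))) ` ?C"
      using that by (auto simp: E5.triangles_def)
    moreover have "(\<Sum>(\<beta>, \<gamma>) \<in> (\<lambda>c. ((b, c), (c, a))) ` ?C. W (a, b) \<beta> \<gamma> * cnj (W (a, b) \<beta> \<gamma>))
        = (\<Sum>c \<in> ?C. cell W a b c * cnj (cell W a b c))"
      by (subst sum.reindex) (auto simp: inj_on_def)
    ultimately show ?thesis
      using R that by (simp only: complex_norm_square [symmetric] of_real_sum [symmetric])
  qed
  then show "E5.type_I W"
    unfolding E5.type_I_def by (auto simp: E5_arcs_betw split: if_splits)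
qed

text \<open>In the absence of parallel arcs the four arcs of condition (II) are given by the corners
  \<open>a, b, c, d\<close> of a closed walk, and the summation over \<open>\<beta>\<^sub>1, \<dots>, \<beta>\<^sub>4\<close> is one over the single
  vertex \<open>k\<close> that spans a triangle with each of its sides.\<close>

lemma E5_type_II_iff:
  "E5.type_II W \<longleftrightarrow> (\<forall>a b c d. (a, b) \<in> E5_arcs \<longrightarrow> (c, b) \<in> E5_arcs \<longrightarrow> (c, d) \<in> E5_arcs \<longrightarrow> (a, d) \<in> E5_arcs \<longrightarrow>
     (\<Sum>k | (b, k) \<in> E5_arcs \<and> (d, k) \<in> E5_arcs \<and> (k, a) \<in> E5_arcs \<and> (k, c) \<in> E5_arcs.
        complex_of_real (inverse (E5_phi k)) *
          (cell W a b k * cnj (cell W c b k) * cell W c d k * cnj (cell W a d k)))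
     = complex_of_real ((if b = d then E5_phi a * E5_phi b * E5_phi c else 0) +
                        (if a = c then E5_phi a * E5_phi b * E5_phi d else 0)))"
proof -
  define L where "L a b c d = (\<Sum>(\<beta>\<^sub>1, \<beta>\<^sub>2, \<beta>\<^sub>3, \<beta>\<^sub>4) \<in> {(\<beta>\<^sub>1, \<beta>\<^sub>2, \<beta>\<^sub>3, \<beta>\<^sub>4).
       ((a, b), \<beta>\<^sub>1, \<beta>\<^sub>2) \<in> E5.triangles \<and> ((c, b), \<beta>\<^sub>1, \<beta>\<^sub>3) \<in> E5.triangles \<and>
       ((c, d), \<beta>\<^sub>4, \<beta>\<^sub>3) \<in> E5.triangles \<and> ((a, d), \<beta>\<^sub>4, \<beta>\<^sub>2) \<in> E5.triangles}.
     complex_of_real (inverse (E5_phi (snd \<beta>\<^sub>1))) *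
       (W (a, b) \<beta>\<^sub>1 \<beta>\<^sub>2 * cnj (W (c, b) \<beta>\<^sub>1 \<beta>\<^sub>3) * W (c, d) \<beta>\<^sub>4 \<beta>\<^sub>3 * cnj (W (a, d) \<beta>\<^sub>4 \<beta>\<^sub>2)))" for a b c d
  have L: "L a b c d = (\<Sum>k | (b, k) \<in> E5_arcs \<and> (d, k) \<in> E5_arcs \<and> (k, a) \<in> E5_arcs \<and> (k, c) \<in> E5_arcs.
        complex_of_real (inverse (E5_phi k)) *
          (cell W a b k * cnj (cell W c b k) * cell W c d k * cnj (cell W a d k)))"
    if "(a, b) \<in> E5_arcs" "(c, b) \<in> E5_arcs" "(c, d) \<in> E5_arcs" "(a, d) \<in> E5_arcs" for a b c d
    unfolding L_def using that
    by (intro sum.reindex_bij_witness[where j = "\<lambda>(\<beta>\<^sub>1, \<beta>\<^sub>2, \<beta>\<^sub>3, \<beta>\<^sub>4). snd \<beta>\<^sub>1"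
          and i = "\<lambda>k. ((b, k), (k, a), (k, c), (d, k))"])
      (auto simp: E5.triangles_def)
  have "E5.type_II W \<longleftrightarrow> (\<forall>a b c d. (a, b) \<in> E5_arcs \<longrightarrow> (c, b) \<in> E5_arcs \<longrightarrow> (c, d) \<in> E5_arcs \<longrightarrow> (a, d) \<in> E5_arcs \<longrightarrow>
     L a b c d = complex_of_real ((if b = d then E5_phi a * E5_phi b * E5_phi c else 0) +
                        (if a = c then E5_phi a * E5_phi b * E5_phi d else 0)))"
    (is "_ \<longleftrightarrow> ?R")
  proof
    assume II: "E5.type_II W"
    show ?R
    proof (intro allI impI)
      fix a b c d assume arcs: "(a, b) \<in> E5_arcs" "(c, b) \<in> E5_arcs" "(c, d) \<in> E5_arcs" "(a, d) \<in> E5_arcs"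
      then have "a \<in> verts E5" "b \<in> verts E5" "c \<in> verts E5" "d \<in> verts E5"
        using E5_verts by auto
      from II[unfolded E5.type_II_def, rule_format, OF this, of "(a, b)" "(c, b)" "(c, d)" "(a, d)"] arcs
      show "L a b c d = complex_of_real ((if b = d then E5_phi a * E5_phi b * E5_phi c else 0) +
                        (if a = c then E5_phi a * E5_phi b * E5_phi d else 0))"
        unfolding L_def by (simp add: E5_arcs_betw)
    qed
  next
    assume R: ?R
    show "E5.type_II W"
      unfolding E5.type_II_def
    proof (intro ballI, goal_cases)
      case (1 a b c d \<alpha>\<^sub>1 \<alpha>\<^sub>2 \<alpha>\<^sub>3 \<alpha>\<^sub>4)
      then have arcs: "(a, b) \<in> E5_arcs" "(c, b) \<in> E5_arcs" "(c, d) \<in> E5_arcs" "(a, d) \<in> E5_arcs"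
        and eq: "\<alpha>\<^sub>1 = (a, b)" "\<alpha>\<^sub>2 = (c, b)" "\<alpha>\<^sub>3 = (c, d)" "\<alpha>\<^sub>4 = (a, d)"
        by (simp_all add: E5_arcs_betw split: if_splits)
      show ?case
        using R[rule_format, OF arcs] unfolding L_def eq
        by (simp only: E5_simps prod.inject simp_thms eq_commute[of c a])
    qed
  qed
  then show ?thesis by (simp add: L)
qed


section \<open>Uniqueness\<close>

text \<open>On a degenerate walk \<open>a \<rightarrow> b \<leftarrow> a \<rightarrow> d \<leftarrow> a\<close> condition (II) forgets the phases and constrains only
  the moduli.\<close>

lemma E5_type_II_out:
  assumes "E5.type_II W" "(a, b) \<in> E5_arcs" "(a, d) \<in> E5_arcs" "b \<noteq> d"
  shows "(\<Sum>k | (b, k) \<in> E5_arcs \<and> (d, k) \<in> E5_arcs \<and> (k, a) \<in> E5_arcs.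
      inverse (E5_phi k) * ((cmod (cell W a b k))\<^sup>2 * (cmod (cell W a d k))\<^sup>2)) = E5_phi a * E5_phi b * E5_phi d"
    (is "?L = ?R")
proof -
  have "complex_of_real ?L = (\<Sum>k | (b, k) \<in> E5_arcs \<and> (d, k) \<in> E5_arcs \<and> (k, a) \<in> E5_arcs \<and> (k, a) \<in> E5_arcs.
        complex_of_real (inverse (E5_phi k)) *
          (cell W a b k * cnj (cell W a b k) * cell W a d k * cnj (cell W a d k)))"
    unfolding of_real_sum
    by (intro sum.cong) (simp_all only: of_real_mult complex_norm_square mult.assoc simp_thms)
  also have "\<dots> = complex_of_real ?R"
    using assms(1)[unfolded E5_type_II_iff, rule_format, OF assms(2,2,3,3)] assms(4) by simp
  finally show ?thesis by (simp only: of_real_eq_iff)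
qed

text \<open>The difference of the squared moduli of two cell systems satisfies the homogeneous version of
  condition (I). This has a two-dimensional solution space, spanned by the alternating signs on the
  corners of the two cubes \<open>{1, 2} \<times> {6, 7} \<times> {12, 13}\<close> and \<open>{1, 3} \<times> {7, 8} \<times> {13, 14}\<close>: every
  arc of a cube lies in exactly two of its corners. Condition (II) for \<open>2 \<rightarrow> 7, 9\<close> and \<open>3 \<rightarrow> 8, 11\<close>
  has a single summand, in which one modulus is already known; so it fixes one corner of each cube.\<close>

lemma E5_equal_norms:
  assumes "E5.cell_system V" "E5.cell_system W" "(a, b, c) \<in> E5_cells"
  shows "cmod (cell V a b c) = cmod (cell W a b c)"
proof -
  have VW: "E5.rotation_invariant V" "E5.rotation_invariant W" "E5.type_I V" "E5.type_I W"
    "E5.type_II V" "E5.type_II W"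
    using assms(1,2) by (simp_all add: E5.cell_system_def)
  define d where "d a b c = (cmod (cell V a b c))\<^sup>2 - (cmod (cell W a b c))\<^sup>2" for a b c
  have "d b c a = d a b c \<and> d c a b = d a b c" if "(a, b, c) \<in> E5_cells" for a b c
    using E5_cells_triangle[OF that] E5_rotation[OF VW(1)] E5_rotation[OF VW(2)] unfolding d_def by metis
  then have "\<forall>(a, b, c) \<in> E5_cells. d b c a = d a b c \<and> d c a b = d a b c" by blast
  note rot = this[unfolded E5_cells_def, simplified]
  have edge: "(\<Sum>c | (b, c) \<in> E5_arcs \<and> (c, a) \<in> E5_arcs. d a b c) = 0" if "(a, b) \<in> E5_arcs" for a b
    using that E5_type_I_edge[OF VW(3)] E5_type_I_edge[OF VW(4)] by (simp add: d_def sum_subtractf)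
  have single: "d a b k = 0"
    if single: "{k. (b, k) \<in> E5_arcs \<and> (e, k) \<in> E5_arcs \<and> (k, a) \<in> E5_arcs} = {k}"
      "(a, b) \<in> E5_arcs" "(a, e) \<in> E5_arcs" "b \<noteq> e" "d a e k = 0" for a b e k
  proof -
    have "E5_phi a * E5_phi b * E5_phi e \<noteq> 0"
      using E5.\<phi>_pos[of a] E5.\<phi>_pos[of b] E5.\<phi>_pos[of e] E5_verts[OF single(2)] E5_verts[OF single(3)] by auto
    moreover have "(cmod (cell V a e k))\<^sup>2 = (cmod (cell W a e k))\<^sup>2"
      using \<open>d a e k = 0\<close> by (simp only: d_def right_minus_eq)
    moreover have "inverse (E5_phi k) * ((cmod (cell U a b k))\<^sup>2 * (cmod (cell U a e k))\<^sup>2)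
        = E5_phi a * E5_phi b * E5_phi e" if "U \<in> {V, W}" for U
      using E5_type_II_out[OF _ single(2,3,4), of U] \<open>U \<in> {V, W}\<close> VW(5,6) unfolding single(1) by auto
    note this[of V] this[of W]
    moreover have "x = y" if "p * (x * m) = r" "p * (y * m) = r" "r \<noteq> 0" for x y p m r :: real
      using that by auto
    ultimately show ?thesis
      unfolding d_def right_minus_eq by (metis insertCI)
  qed
  \<comment> \<open>Arcs that lie in one triangle only.\<close>
  have 1: "d 3 11 14 = 0" "d 3 8 17 = 0" "d 4 10 15 = 0" "d 5 9 16 = 0" "d 5 8 13 = 0" "d 2 9 13 = 0"
    using edge[of 3 11] edge[of 8 17] edge[of 4 10] edge[of 9 16] edge[of 5 8] edge[of 2 9]
    by (simp_all add: E5_eval rot)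
  have 2: "d 4 7 14 = 0" "d 2 7 15 = 0"
    using edge[of 14 4] edge[of 15 2] by (simp_all add: E5_eval rot)
  have 3: "d 4 7 15 = 0" "d 5 9 13 = 0"
    using edge[of 4 7] edge[of 5 9] by (simp_all add: E5_eval rot 1 2)
  \<comment> \<open>One cell of each cube comes from condition (II); the others follow along the edges of the cubes.\<close>
  have 4: "d 2 7 13 = 0" "d 3 8 14 = 0"
    using single[of 7 9 2 13] single[of 8 11 3 14] by (simp_all add: E5_eval 1)
  have 5: "d 2 6 13 = 0" "d 2 7 12 = 0" "d 3 8 13 = 0" "d 3 7 14 = 0" "d 1 8 14 = 0"
    using edge[of 13 2] edge[of 2 7] edge[of 3 8] edge[of 14 3] edge[of 8 14]
    by (simp_all add: E5_eval rot 1 2 4)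
  have 6: "d 2 6 12 = 0" "d 1 6 13 = 0" "d 1 7 12 = 0" "d 1 8 13 = 0" "d 1 7 14 = 0" "d 3 7 13 = 0"
    using edge[of 2 6] edge[of 6 13] edge[of 7 12] edge[of 1 8] edge[of 14 1] edge[of 3 7]
    by (simp_all add: E5_eval rot 4 5)
  have 7: "d 1 6 12 = 0" "d 1 7 13 = 0"
    using edge[of 1 6] edge[of 1 7] by (simp_all add: E5_eval rot 6)
  have "\<forall>(a, b, c) \<in> E5_cells. d a b c = 0"
    unfolding E5_cells_def by (simp add: 1 2 3 4 5 6 7)
  then show ?thesis using assms(3) by (auto simp: d_def)
qed

text \<open>On a nondegenerate 4-cycle with exactly two common third vertices \<open>k\<close> and \<open>l\<close>, condition (II) says
  that two nonzero numbers add up to zero. So their ratio is the same for \<open>V\<close> and \<open>W\<close>, and the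
  phases \<open>\<theta>\<close> by which \<open>V\<close> differs from \<open>W\<close> cancel. The eight cells involved are the corners
  of a cube \<open>{a, c} \<times> {b, d} \<times> {k, l}\<close>, and the relation is that the alternating product of \<open>\<theta>\<close>
  over the corners is 1.\<close>

lemma E5_cube:
  assumes "E5.type_II V" "E5.type_II W"
    and arcs: "(a, b) \<in> E5_arcs" "(c, b) \<in> E5_arcs" "(c, d) \<in> E5_arcs" "(a, d) \<in> E5_arcs"
    and "a \<noteq> c" "b \<noteq> d" "k \<noteq> l"
    and K: "{k. (b, k) \<in> E5_arcs \<and> (d, k) \<in> E5_arcs \<and> (k, a) \<in> E5_arcs \<and> (k, c) \<in> E5_arcs} = {k, l}"
    and V: "\<And>x y z. (x, y) \<in> E5_arcs \<Longrightarrow> (y, z) \<in> E5_arcs \<Longrightarrow> (z, x) \<in> E5_arcs \<Longrightarrow>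
      cell V x y z = \<theta> x y z * cell W x y z \<and> cmod (\<theta> x y z) = 1 \<and> cell W x y z \<noteq> 0"
  shows "\<theta> a b k * \<theta> c d k * \<theta> c b l * \<theta> a d l = \<theta> c b k * \<theta> a d k * \<theta> a b l * \<theta> c d l"
proof -
  define i where "i j = complex_of_real (inverse (E5_phi j))" for j
  define P where "P j = cell W a b j * cnj (cell W c b j) * cell W c d j * cnj (cell W a d j)" for j
  define \<tau> where "\<tau> j = \<theta> a b j * cnj (\<theta> c b j) * \<theta> c d j * cnj (\<theta> a d j)" for j
  have kl: "(b, j) \<in> E5_arcs" "(d, j) \<in> E5_arcs" "(j, a) \<in> E5_arcs" "(j, c) \<in> E5_arcs" if "j \<in> {k, l}" for j
    using K that by auto
  have tri: "cell V a b j = \<theta> a b j * cell W a b j" "cell V c b j = \<theta> c b j * cell W c b j"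
      "cell V c d j = \<theta> c d j * cell W c d j" "cell V a d j = \<theta> a d j * cell W a d j"
      "P j \<noteq> 0"
      "cnj (\<theta> c b j) * \<theta> c b j = 1" "cnj (\<theta> a d j) * \<theta> a d j = 1"
      if "j \<in> {k, l}" for j
    using V[of a b j] V[of c b j] V[of c d j] V[of a d j] arcs kl[OF that]
    by (auto simp: P_def complex_norm_square [symmetric] mult.commute[of "cnj _"])
  have "i k * P k + i l * P l = 0"
    using assms(2)[unfolded E5_type_II_iff, rule_format, OF arcs] \<open>a \<noteq> c\<close> \<open>b \<noteq> d\<close> \<open>k \<noteq> l\<close>
    unfolding K by (simp add: i_def P_def)
  moreover have "i k * (\<tau> k * P k) + i l * (\<tau> l * P l) = 0"
    using assms(1)[unfolded E5_type_II_iff, rule_format, OF arcs] \<open>a \<noteq> c\<close> \<open>b \<noteq> d\<close> \<open>k \<noteq> l\<close>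
    unfolding K by (simp add: i_def P_def \<tau>_def tri mult_ac)
  ultimately have "(\<tau> k - \<tau> l) * (i k * P k) = 0" by algebra
  moreover have "i k \<noteq> 0"
    using E5.\<phi>_pos[of k] E5_verts[OF kl(1)[of k]] by (simp add: i_def)
  ultimately have \<tau>: "\<tau> k = \<tau> l" using tri(5)[of k] by simp
  have \<tau>': "\<tau> j * (\<theta> c b j * \<theta> a d j) = \<theta> a b j * \<theta> c d j" if "j \<in> {k, l}" for j
    using tri(6,7)[OF that] unfolding \<tau>_def by algebra
  show ?thesis
    using \<tau>'[of k] \<tau>'[of l] \<tau> by simp algebra
qed

text \<open>Phases on triangles come from phases on arcs as soon as they are compatible with the two cubes
  \<open>{1, 2} \<times> {6, 7} \<times> {12, 13}\<close> and \<open>{1, 3} \<times> {7, 8} \<times> {13, 14}\<close>. Without the corners \<open>(2, 7, 13)\<close> and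
  \<open>(3, 7, 13)\<close> the triangles can be listed such that each of them has an arc that occurs in no
  earlier one; this arc absorbs the phase of the triangle. The cube relations are exactly what
  makes the two remaining triangles come out right.\<close>

lemma E5_gauge:
  fixes \<theta> :: "nat \<Rightarrow> nat \<Rightarrow> nat \<Rightarrow> complex"
  assumes unit: "\<And>a b c. (a, b, c) \<in> E5_cells \<Longrightarrow> cmod (\<theta> a b c) = 1"
    and cube1: "\<theta> 1 6 12 * \<theta> 2 7 12 * \<theta> 2 6 13 * \<theta> 1 7 13 = \<theta> 2 6 12 * \<theta> 1 7 12 * \<theta> 1 6 13 * \<theta> 2 7 13"
    and cube2: "\<theta> 1 7 13 * \<theta> 3 8 13 * \<theta> 3 7 14 * \<theta> 1 8 14 = \<theta> 3 7 13 * \<theta> 1 8 13 * \<theta> 1 7 14 * \<theta> 3 8 14"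
  obtains u where "\<And>e. cmod (u e) = 1"
    "\<And>a b c. (a, b, c) \<in> E5_cells \<Longrightarrow> \<theta> a b c = u (a, b) * u (b, c) * u (c, a)"
proof -
  have "\<forall>(a, b, c) \<in> E5_cells. cmod (\<theta> a b c) = 1" using unit by blast
  note norm = this[unfolded E5_cells_def, simplified]
  have "\<forall>(a, b, c) \<in> E5_cells. \<theta> a b c \<noteq> 0" using unit by force
  note nz = this[unfolded E5_cells_def, simplified]
  \<comment> \<open>All arcs at the vertex 1 get phase 1, so that the arc opposite to 1 carries the phase of its triangle.\<close>
  define u12_2 where "u12_2 = \<theta> 2 6 12 / \<theta> 1 6 12"
  define u13_2 where "u13_2 = \<theta> 2 6 13 / \<theta> 1 6 13"
  define u13_3 where "u13_3 = \<theta> 3 8 13 / \<theta> 1 8 13"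
  define u13_5 where "u13_5 = \<theta> 5 8 13 / \<theta> 1 8 13"
  define u14_3 where "u14_3 = \<theta> 3 8 14 / \<theta> 1 8 14"
  define u14_4 where "u14_4 = \<theta> 4 7 14 / \<theta> 1 7 14"
  define u2_7 where "u2_7 = \<theta> 2 7 12 / (\<theta> 1 7 12 * u12_2)"
  define u3_7 where "u3_7 = \<theta> 3 7 14 / (\<theta> 1 7 14 * u14_3)"
  define u7_15 where "u7_15 = \<theta> 2 7 15 / u2_7"
  define u15_4 where "u15_4 = \<theta> 4 7 15 / u7_15"
  define u9_13 where "u9_13 = \<theta> 2 9 13 / u13_2"
  define u5_9 where "u5_9 = \<theta> 5 9 13 / (u9_13 * u13_5)"
  note defs = u12_2_def u13_2_def u13_3_def u13_5_def u14_3_def u14_4_def u2_7_def u3_7_def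
    u7_15_def u15_4_def u9_13_def u5_9_def
  define u :: "nat \<times> nat \<Rightarrow> complex" where "u = (\<lambda>_. 1)(
      (6, 12) := \<theta> 1 6 12, (6, 13) := \<theta> 1 6 13, (7, 12) := \<theta> 1 7 12, (7, 13) := \<theta> 1 7 13,
      (7, 14) := \<theta> 1 7 14, (8, 13) := \<theta> 1 8 13, (8, 14) := \<theta> 1 8 14,
      (12, 2) := u12_2, (13, 2) := u13_2, (13, 3) := u13_3, (13, 5) := u13_5, (14, 3) := u14_3, (14, 4) := u14_4,
      (2, 7) := u2_7, (3, 7) := u3_7, (7, 15) := u7_15, (15, 4) := u15_4, (9, 13) := u9_13, (5, 9) := u5_9,
      (8, 17) := \<theta> 3 8 17, (11, 14) := \<theta> 3 11 14 / u14_3, (4, 10) := \<theta> 4 10 15 / u15_4,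
      (9, 16) := \<theta> 5 9 16 / u5_9)"
  have "cmod (u e) = 1" for e
    unfolding u_def fun_upd_apply if_distrib[of cmod] defs
    by (simp only: norm norm_mult norm_divide norm_one if_cancel mult_1 div_by_1)
  moreover have "\<theta> 2 7 13 = u2_7 * \<theta> 1 7 13 * u13_2" "\<theta> 3 7 13 = u3_7 * \<theta> 1 7 13 * u13_3"
    using cube1 cube2 nz by (simp_all add: defs field_simps)
  then have "\<forall>(a, b, c) \<in> E5_cells. \<theta> a b c = u (a, b) * u (b, c) * u (c, a)"
    unfolding E5_cells_def using nz by (simp add: u_def) (simp add: defs field_simps)
  ultimately show ?thesis using that by blast
qed

text \<open>The unitary matrices of an equivalence are \<open>1 \<times> 1\<close>, that is, phases.\<close>

lemma E5_equivalentI: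
  assumes "E5.rotation_invariant V" "E5.rotation_invariant W" "\<And>e. cmod (u e) = 1"
    and cells: "\<And>a b c. (a, b, c) \<in> E5_cells \<Longrightarrow>
      cell V a b c = u (a, b) * u (b, c) * u (c, a) * cell W a b c"
  shows "E5.equivalent V W"
proof -
  have "cell V a b c = u (a, b) * u (b, c) * u (c, a) * cell W a b c"
    if "(a, b) \<in> E5_arcs" "(b, c) \<in> E5_arcs" "(c, a) \<in> E5_arcs" for a b c
    using that
  proof (induction rule: E5_triangle_induct)
    case (rotate a b c)
    then show ?case
      by (simp add: E5_rotation[OF assms(1)] E5_rotation[OF assms(2)])
  qed (fact cells)
  moreover have "u e * cnj (u e) = 1" for e
    using assms(3)[of e] by (simp flip: complex_norm_square)
  ultimately show ?thesis
    unfolding E5.equivalent_def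
    by (intro exI[of _ "\<lambda>\<sigma> \<sigma>'. u \<sigma>"])
      (simp add: E5_arcs_betw E5.unitary_on_def mult.commute)
qed

lemma E5_equivalent:
  assumes V: "E5.cell_system V" and W: "E5.cell_system W"
    and nz: "\<And>a b c. (a, b, c) \<in> E5_cells \<Longrightarrow> cell W a b c \<noteq> 0"
  shows "E5.equivalent V W"
proof -
  have VW: "E5.rotation_invariant V" "E5.rotation_invariant W" "E5.type_II V" "E5.type_II W"
    using V W by (simp_all add: E5.cell_system_def)
  define \<theta> where "\<theta> a b c = cell V a b c / cell W a b c" for a b c
  have \<theta>: "cell V a b c = \<theta> a b c * cell W a b c \<and> cmod (\<theta> a b c) = 1 \<and> cell W a b c \<noteq> 0"
    if "(a, b) \<in> E5_arcs" "(b, c) \<in> E5_arcs" "(c, a) \<in> E5_arcs" for a b c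
    using that
  proof (induction rule: E5_triangle_induct)
    case (cell a b c)
    then show ?case
      using nz E5_equal_norms[OF V W cell] by (simp add: \<theta>_def norm_divide)
  next
    case (rotate a b c)
    then show ?case
      by (simp add: \<theta>_def E5_rotation[OF VW(1)] E5_rotation[OF VW(2)])
  qed
  have \<theta>_cell: "cell V a b c = \<theta> a b c * cell W a b c" "cmod (\<theta> a b c) = 1" if "(a, b, c) \<in> E5_cells" for a b c
    using \<theta> E5_cells_triangle[OF that] by blast+
  obtain u where u: "\<And>e. cmod (u e) = 1"
    "\<And>a b c. (a, b, c) \<in> E5_cells \<Longrightarrow> \<theta> a b c = u (a, b) * u (b, c) * u (c, a)"
  proof (rule E5_gauge[of \<theta>])
    show "\<theta> 1 6 12 * \<theta> 2 7 12 * \<theta> 2 6 13 * \<theta> 1 7 13 = \<theta> 2 6 12 * \<theta> 1 7 12 * \<theta> 1 6 13 * \<theta> 2 7 13"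
      by (rule E5_cube[OF VW(3,4) _ _ _ _ _ _ _ _ \<theta>]) (simp_all add: E5_eval insert_commute)
    show "\<theta> 1 7 13 * \<theta> 3 8 13 * \<theta> 3 7 14 * \<theta> 1 8 14 = \<theta> 3 7 13 * \<theta> 1 8 13 * \<theta> 1 7 14 * \<theta> 3 8 14"
      by (rule E5_cube[OF VW(3,4) _ _ _ _ _ _ _ _ \<theta>]) (simp_all add: E5_eval insert_commute)
  qed (use \<theta>_cell in auto)
  show ?thesis
    by (rule E5_equivalentI[of V W u, OF VW(1,2) u(1)]) (simp add: \<theta>_cell u(2))
qed


section \<open>Existence\<close>

text \<open>The squared modulus of the cell divided by \<open>[2]\<close>, which lies in \<open>\<int>[[3]]\<close>, a ring in which everything
  is a linear polynomial in \<open>[3]\<close> because of \<open>[3]\<^sup>2 = 2 [3] + 2\<close>. The values are the solution of the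
  equations that determine the moduli in \<open>E5_equal_norms\<close>.\<close>

definition E5_cell_weight :: "nat \<Rightarrow> nat \<Rightarrow> nat \<Rightarrow> real" where
  "E5_cell_weight a b c =
     (if (a, b, c) \<in> {(1, 6, 12), (4, 10, 15), (5, 9, 16)} then qint[3]
      else if (a, b, c) \<in> {(1, 6, 13), (1, 7, 12)} then 5 * qint[3] + 4
      else if (a, b, c) \<in> {(1, 7, 13), (3, 7, 14), (3, 8, 13), (3, 8, 17), (3, 11, 14)} then 3 * qint[3]
      else if (a, b, c) \<in> {(2, 7, 15), (2, 9, 13), (4, 7, 14), (5, 8, 13)} then 4 * qint[3] + 2
      else if (a, b, c) = (1, 8, 14) then 6 * qint[3]
      else if (a, b, c) \<in> {(1, 7, 14), (1, 8, 13)} then 2 * qint[3] + 4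
      else if (a, b, c) \<in> {(2, 6, 12), (2, 7, 13)} then 3 * qint[3] + 3
      else if (a, b, c) \<in> {(2, 6, 13), (2, 7, 12)} then 2 * qint[3] + 1
      else if (a, b, c) = (3, 7, 13) then 6 * qint[3] + 6
      else if (a, b, c) = (3, 8, 14) then 6
      else if (a, b, c) \<in> {(4, 7, 15), (5, 9, 13)} then qint[3] + 2
      else 0)"

text \<open>The rotation that puts the vertex in \<open>{1..5}\<close> first.\<close>

definition E5_weight :: "nat \<Rightarrow> nat \<Rightarrow> nat \<Rightarrow> real" where
  "E5_weight a b c =
     (if a \<le> 5 then E5_cell_weight a b c else if b \<le> 5 then E5_cell_weight b c a else E5_cell_weight c a b)"

text \<open>Negative on all rotations of one corner of each cube. Condition (II) requires an odd number of negative
  corners in each cube, and their common corner \<open>(1, 7, 13)\<close> is positive.\<close>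

definition E5_sign :: "nat \<Rightarrow> nat \<Rightarrow> nat \<Rightarrow> real" where
  "E5_sign a b c =
     (if (a, b, c) \<in> {(2, 7, 13), (7, 13, 2), (13, 2, 7), (3, 7, 13), (7, 13, 3), (13, 3, 7)} then -1 else 1)"

definition E5_value :: "nat \<Rightarrow> nat \<Rightarrow> nat \<Rightarrow> real" where
  "E5_value a b c = E5_sign a b c * sqrt (qint[2] * E5_weight a b c)"

lemma qint3_reduce: "qint[3] * qint[3] = 2 * qint[3] + 2" "qint[3] * (qint[3] * x) = 2 * (qint[3] * x) + 2 * x"
proof -
  show "qint[3] * qint[3] = 2 * qint[3] + 2"
    using qint_relations(3) by (simp only: power2_eq_square)
  then show "qint[3] * (qint[3] * x) = 2 * (qint[3] * x) + 2 * x"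
    by (metis mult.assoc distrib_right)
qed

text \<open>With the inverses also written as linear polynomials in \<open>[3]\<close>, condition (II) is free of
  denominators that involve \<open>[3]\<close>, and its degenerate cases are checked by reducing polynomials.\<close>

lemma E5_phi_inverse:
  assumes "k \<in> {1..17}"
  shows "inverse (E5_phi k) =
     (if k = 1 then (qint[3] - 2) / 4
      else if k \<in> {2, 3, 8, 14} then (4 - qint[3]) / 6
      else if k \<in> {4, 5, 9, 15} then (qint[3] - 2) / 2
      else if k \<in> {6, 12} then 3 - qint[3]
      else if k \<in> {7, 13} then (2 * qint[3] - 5) / 3
      else if k \<in> {10, 16} then 1
      else (qint[3] - 1) / 3)"
  using E5.\<phi>_pos[of k] assms unfolding E5_phi_linear
  by (intro inverse_unique) (simp_all add: algebra_simps qint3_reduce)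

lemma E5_weight_cell:
  "\<forall>(a, b, c) \<in> E5_cells. E5_weight a b c = E5_cell_weight a b c \<and>
     E5_weight b c a = E5_cell_weight a b c \<and> E5_weight c a b = E5_cell_weight a b c"
  unfolding E5_cells_def by (simp add: E5_weight_def)

lemma E5_cell_weight_values:
  "E5_cell_weight 1 6 12 = qint[3]"
  "E5_cell_weight 1 6 13 = 5 * qint[3] + 4"
  "E5_cell_weight 1 7 12 = 5 * qint[3] + 4"
  "E5_cell_weight 1 7 13 = 3 * qint[3]"
  "E5_cell_weight 1 7 14 = 2 * qint[3] + 4"
  "E5_cell_weight 1 8 13 = 2 * qint[3] + 4"
  "E5_cell_weight 1 8 14 = 6 * qint[3]"
  "E5_cell_weight 2 6 12 = 3 * qint[3] + 3"
  "E5_cell_weight 2 6 13 = 2 * qint[3] + 1"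
  "E5_cell_weight 2 7 12 = 2 * qint[3] + 1"
  "E5_cell_weight 2 7 13 = 3 * qint[3] + 3"
  "E5_cell_weight 2 7 15 = 4 * qint[3] + 2"
  "E5_cell_weight 2 9 13 = 4 * qint[3] + 2"
  "E5_cell_weight 3 7 13 = 6 * qint[3] + 6"
  "E5_cell_weight 3 7 14 = 3 * qint[3]"
  "E5_cell_weight 3 8 13 = 3 * qint[3]"
  "E5_cell_weight 3 8 14 = 6"
  "E5_cell_weight 3 8 17 = 3 * qint[3]"
  "E5_cell_weight 3 11 14 = 3 * qint[3]"
  "E5_cell_weight 4 7 14 = 4 * qint[3] + 2"
  "E5_cell_weight 4 7 15 = qint[3] + 2"
  "E5_cell_weight 4 10 15 = qint[3]"
  "E5_cell_weight 5 8 13 = 4 * qint[3] + 2"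
  "E5_cell_weight 5 9 13 = qint[3] + 2"
  "E5_cell_weight 5 9 16 = qint[3]"
  by (simp_all add: E5_cell_weight_def)

lemmas E5_weight_values = E5_weight_cell[unfolded E5_cells_def, simplified] E5_cell_weight_values

lemma E5_weight_type_I:
  "\<forall>(a, b) \<in> E5_arcs. (\<Sum>c | (b, c) \<in> E5_arcs \<and> (c, a) \<in> E5_arcs. E5_weight a b c) = E5_phi a * E5_phi b"
  apply (subst (1) E5_arcs_def)
  apply (simp add: E5_eval)
  apply (simp add: E5_weight_values E5_phi_linear)
  apply (simp add: algebra_simps qint3_reduce)
  done

text \<open>The two degenerate kinds of walks in condition (II), with the factor \<open>[2]\<^sup>2 = [3] + 1\<close> that turns
  weights into squared moduli: \<open>c = a\<close> here, and \<open>d = b\<close> below.\<close>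

lemma E5_weight_out:
  "\<forall>(a, b) \<in> E5_arcs. \<forall>d. (a, d) \<in> E5_arcs \<longrightarrow>
     (qint[3] + 1) * (\<Sum>k | (b, k) \<in> E5_arcs \<and> (d, k) \<in> E5_arcs \<and> (k, a) \<in> E5_arcs.
        inverse (E5_phi k) * (E5_weight a b k * E5_weight a d k))
     = (if b = d then E5_phi a * E5_phi b * E5_phi a else 0) + E5_phi a * E5_phi b * E5_phi d"
  apply (subst (1) E5_arcs_def)
  apply (simp add: E5_eval all_conj_distrib imp_disjL)
  apply (simp add: E5_weight_values E5_phi_inverse)
  apply (simp add: E5_phi_linear)
  apply (simp add: field_simps qint3_reduce)
  done

lemma E5_weight_in:
  "\<forall>(a, b) \<in> E5_arcs. \<forall>c. (c, b) \<in> E5_arcs \<longrightarrow> a \<noteq> c \<longrightarrow>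
     (qint[3] + 1) * (\<Sum>k | (b, k) \<in> E5_arcs \<and> (k, a) \<in> E5_arcs \<and> (k, c) \<in> E5_arcs.
        inverse (E5_phi k) * (E5_weight a b k * E5_weight c b k))
     = E5_phi a * E5_phi b * E5_phi c"
  apply (subst (1) E5_arcs_def)
  apply (simp add: E5_eval E5_in all_conj_distrib imp_disjL)
  apply (simp add: E5_weight_values E5_phi_inverse)
  apply (simp add: E5_phi_linear)
  apply (simp add: field_simps qint3_reduce)
  done

text \<open>Collecting each summand under a single root reduces the nondegenerate cases of condition (II)
  to an equality of radicands, which are polynomials in \<open>[3]\<close>, together with opposite signs.\<close>

lemma E5_value_frame:
  assumes "k \<in> {1..17}"
  shows "inverse (E5_phi k) *
      (E5_value a b k * E5_value c b k * E5_value c d k * E5_value a d k)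
    = E5_sign a b k * E5_sign c b k * E5_sign c d k * E5_sign a d k * ((qint[2])\<^sup>2 *
      sqrt ((inverse (E5_phi k))\<^sup>2 * (E5_weight a b k * E5_weight c b k * E5_weight c d k * E5_weight a d k)))"
proof -
  have "E5_phi k > 0" using E5.\<phi>_pos[of k] assms by simp
  then have \<phi>: "sqrt ((inverse (E5_phi k))\<^sup>2) = inverse (E5_phi k)" by simp
  have "qint[2] > 0" by (rule qint_pos) auto
  then obtain r where r: "sqrt (qint[2]) = r" "qint[2] = r * r"
    by (metis less_imp_le real_sqrt_mult_self abs_of_nonneg)
  show ?thesis
    unfolding E5_value_def real_sqrt_mult \<phi> r(1) by (simp add: r(2) power2_eq_square)
qed

text \<open>Each of the two cubes \<open>{1, 2} \<times> {6, 7} \<times> {12, 13}\<close> and \<open>{1, 3} \<times> {7, 8} \<times> {13, 14}\<close> contributes three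
  cycles, obtained by dropping one of its factors.\<close>

lemma E5_cycle_cases:
  assumes "(a, b) \<in> E5_arcs" "(a, d) \<in> E5_arcs" "(c, b) \<in> E5_arcs" "(c, d) \<in> E5_arcs" "a < c" "b < d"
    and P: "P 1 6 2 7" "P 1 7 3 8" "P 6 12 7 13" "P 7 13 8 14" "P 12 1 13 2" "P 13 1 14 3"
  shows "P a b c d"
proof -
  have "\<forall>(a, b) \<in> E5_arcs. \<forall>d. (a, d) \<in> E5_arcs \<longrightarrow> b < d \<longrightarrow>
     (\<forall>c. (c, b) \<in> E5_arcs \<longrightarrow> a < c \<longrightarrow> (c, d) \<in> E5_arcs \<longrightarrow> P a b c d)"
    by (subst (1) E5_arcs_def) (simp add: E5_out E5_in all_conj_distrib imp_disjL P)
  with assms show ?thesis by blast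
qed

lemma E5_value_cycle:
  assumes "(a, b) \<in> E5_arcs" "(a, d) \<in> E5_arcs" "(c, b) \<in> E5_arcs" "(c, d) \<in> E5_arcs" "a < c" "b < d"
  shows "(\<Sum>k | (b, k) \<in> E5_arcs \<and> (d, k) \<in> E5_arcs \<and> (k, a) \<in> E5_arcs \<and> (k, c) \<in> E5_arcs.
          inverse (E5_phi k) *
          (E5_value a b k * E5_value c b k * E5_value c d k * E5_value a d k)) = 0"
  using assms
  apply (rule E5_cycle_cases)
  apply (simp_all add: E5_eval)
  apply (simp_all add: E5_value_frame)
  apply (simp_all add: E5_sign_def E5_weight_values E5_phi_inverse)
  apply (simp_all add: field_simps power2_eq_square qint3_reduce)
  done

lemma E5_weight_nonneg: "E5_weight a b c \<ge> 0"
proof -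
  have if_nonneg: "(if P then x else y) \<ge> 0" if "x \<ge> 0" "y \<ge> 0" for P and x y :: real
    using that by simp
  have "E5_cell_weight a b c \<ge> 0" for a b c
    unfolding E5_cell_weight_def using qint_pos[of 3] by (intro if_nonneg) simp_all
  then show ?thesis
    by (simp add: E5_weight_def)
qed

lemma E5_weight_pos: "(a, b, c) \<in> E5_cells \<Longrightarrow> E5_weight a b c > 0"
proof -
  have "\<forall>(a, b, c) \<in> E5_cells. E5_weight a b c > 0"
    unfolding E5_cells_def using qint_pos[of 3] by (simp add: E5_weight_values)
  then show "(a, b, c) \<in> E5_cells \<Longrightarrow> E5_weight a b c > 0" by blast
qed

lemma E5_value_rotate:
  assumes "(a, b) \<in> E5_arcs" "(b, c) \<in> E5_arcs" "(c, a) \<in> E5_arcs"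
  shows "E5_value b c a = E5_value a b c"
proof -
  have "E5_weight b c a = E5_weight a b c"
    using E5_triangle_rotate[OF assms] E5_weight_cell by fastforce
  then show ?thesis
    by (auto simp: E5_value_def E5_sign_def)
qed

lemma E5_value_square: "(E5_value a b c)\<^sup>2 = qint[2] * E5_weight a b c"
  using qint_pos[of 2] E5_weight_nonneg[of a b c]
  by (simp add: E5_value_def E5_sign_def power_mult_distrib)

definition E5_W :: "nat \<times> nat \<Rightarrow> nat \<times> nat \<Rightarrow> nat \<times> nat \<Rightarrow> complex" where
  "E5_W \<alpha> \<beta> \<gamma> = complex_of_real (E5_value (fst \<alpha>) (fst \<beta>) (fst \<gamma>))"

lemma cell_E5_W: "cell E5_W a b c = complex_of_real (E5_value a b c)"
  by (simp add: E5_W_def)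

text \<open>In a degenerate walk the values occur as squares, so the equations for the weights apply. A
  nondegenerate one can be normalized to \<open>a < c\<close> and \<open>b < d\<close>, because the values are real and the
  summand is then symmetric in \<open>a, c\<close> and in \<open>b, d\<close>.\<close>

lemma E5_value_type_II:
  assumes arcs: "(a, b) \<in> E5_arcs" "(c, b) \<in> E5_arcs" "(c, d) \<in> E5_arcs" "(a, d) \<in> E5_arcs"
  shows "(\<Sum>k | (b, k) \<in> E5_arcs \<and> (d, k) \<in> E5_arcs \<and> (k, a) \<in> E5_arcs \<and> (k, c) \<in> E5_arcs.
      inverse (E5_phi k) *
      (E5_value a b k * E5_value c b k * E5_value c d k * E5_value a d k))
    = (if b = d then E5_phi a * E5_phi b * E5_phi c else 0) + (if a = c then E5_phi a * E5_phi b * E5_phi d else 0)"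
    (is "?S a b c d = _")
proof -
  have square: "inverse (E5_phi k) * (E5_value a b k * E5_value a b k * E5_value c d k * E5_value c d k)
      = (qint[3] + 1) * (inverse (E5_phi k) * (E5_weight a b k * E5_weight c d k))" for a b c d k
  proof -
    have "inverse (E5_phi k) * (E5_value a b k * E5_value a b k * E5_value c d k * E5_value c d k)
        = inverse (E5_phi k) * ((E5_value a b k)\<^sup>2 * (E5_value c d k)\<^sup>2)"
      by (simp only: power2_eq_square mult.assoc)
    also have "\<dots> = (qint[2])\<^sup>2 * (inverse (E5_phi k) * (E5_weight a b k * E5_weight c d k))"
      by (simp only: E5_value_square) (simp add: power2_eq_square)
    finally show ?thesis by (simp only: qint_relations(1))
  qed
  consider "a = c" | "a \<noteq> c" "b = d" | "a \<noteq> c" "b \<noteq> d" by blast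
  then show ?thesis
  proof cases
    case 1
    have "?S a b c d = (qint[3] + 1) * (\<Sum>k | (b, k) \<in> E5_arcs \<and> (d, k) \<in> E5_arcs \<and> (k, a) \<in> E5_arcs.
        inverse (E5_phi k) * (E5_weight a b k * E5_weight a d k))"
      unfolding sum_distrib_left 1 [symmetric] by (intro sum.cong) (simp_all only: square simp_thms)
    with E5_weight_out[THEN bspec, OF arcs(1)] arcs(4) 1 show ?thesis by simp
  next
    case 2
    have "?S a b c d = (qint[3] + 1) * (\<Sum>k | (b, k) \<in> E5_arcs \<and> (k, a) \<in> E5_arcs \<and> (k, c) \<in> E5_arcs.
        inverse (E5_phi k) * (E5_weight a b k * E5_weight c b k))"
      unfolding sum_distrib_left 2(2) [symmetric] square [symmetric]
      by (intro sum.cong) auto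
    with E5_weight_in[THEN bspec, OF arcs(1)] arcs(2) 2 show ?thesis by simp
  next
    case 3
    have swap: "?S c b a d = ?S a b c d" "?S a d c b = ?S a b c d" "?S c d a b = ?S a b c d"
      by (intro sum.cong; auto)+
    have "?S a b c d = 0"
      using 3 E5_value_cycle[OF arcs(1,4,2,3)] E5_value_cycle[OF arcs(2,3,1,4)]
        E5_value_cycle[OF arcs(4,1,3,2)] E5_value_cycle[OF arcs(3,2,4,1)]
      unfolding swap by (meson linorder_neqE_nat)
    with 3 show ?thesis by simp
  qed
qed

lemma E5_W_cell_system: "E5.cell_system E5_W"
  unfolding E5.cell_system_def
proof (intro conjI)
  show "E5.rotation_invariant E5_W"
    unfolding E5.rotation_invariant_def E5.triangles_def
    by (auto simp: E5_W_def E5_value_rotate)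
  have "(cmod (cell E5_W a b c))\<^sup>2 = qint[2] * E5_weight a b c" for a b c
    by (simp only: cell_E5_W norm_of_real power2_abs E5_value_square)
  then show "E5.type_I E5_W"
    unfolding E5_type_I_iff using E5_weight_type_I
    by (auto simp flip: sum_distrib_left)
  show "E5.type_II E5_W"
    unfolding E5_type_II_iff cell_E5_W complex_cnj_complex_of_real of_real_mult [symmetric]
      of_real_sum [symmetric] of_real_eq_iff
    using E5_value_type_II by blast
qed

text \<open>Up to sign, a value is the nonnegative number with square \<open>[2]\<close> times the weight, so it suffices to
  square each formula and to reduce by \<open>[4] = [2] ([3] - 1)\<close>, \<open>[6] = 2 [2]\<close> and \<open>[2]\<^sup>2 = [3] + 1\<close>.\<close>

lemma E5_value_formulas:
  "E5_value 1 6 12 = sqrt (qint[2] * qint[3])"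
  "E5_value 4 10 15 = sqrt (qint[2] * qint[3])"
  "E5_value 5 9 16 = sqrt (qint[2] * qint[3])"
  "E5_value 1 6 13 = qint[2] * sqrt (qint[3] * qint[4])"
  "E5_value 1 7 12 = qint[2] * sqrt (qint[3] * qint[4])"
  "E5_value 1 7 13 = qint[4] * sqrt (qint[3]) / sqrt (qint[2])"
  "E5_value 3 7 14 = qint[4] * sqrt (qint[3]) / sqrt (qint[2])"
  "E5_value 3 8 13 = qint[4] * sqrt (qint[3]) / sqrt (qint[2])"
  "E5_value 3 8 17 = qint[4] * sqrt (qint[3]) / sqrt (qint[2])"
  "E5_value 3 11 14 = qint[4] * sqrt (qint[3]) / sqrt (qint[2])"
  "E5_value 2 7 15 = qint[3] * sqrt (qint[4])"
  "E5_value 2 9 13 = qint[3] * sqrt (qint[4])"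
  "E5_value 4 7 14 = qint[3] * sqrt (qint[4])"
  "E5_value 5 8 13 = qint[3] * sqrt (qint[4])"
  "E5_value 1 8 14 = qint[4] * sqrt (qint[3] * qint[6]) / qint[2]"
  "E5_value 1 7 14 = sqrt (qint[3] * qint[4] * qint[6]) / sqrt (qint[2])"
  "E5_value 1 8 13 = sqrt (qint[3] * qint[4] * qint[6]) / sqrt (qint[2])"
  "E5_value 2 6 12 = qint[4] * sqrt (qint[2])"
  "E5_value 2 6 13 = qint[2] * sqrt (qint[4])"
  "E5_value 2 7 12 = qint[2] * sqrt (qint[4])"
  "E5_value 2 7 13 = - (qint[4] * sqrt (qint[2]))"
  "E5_value 3 7 13 = - (qint[4] * sqrt (qint[6]))"
  "E5_value 3 8 14 = qint[4] * sqrt (qint[6]) / qint[2]"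
  "E5_value 4 7 15 = sqrt (qint[3] * qint[4])"
  "E5_value 5 9 13 = sqrt (qint[3] * qint[4])"
proof -
  define s where "s = qint[2]"
  define t where "t = qint[3]"
  have s: "s > 0" and t: "t > 0" unfolding s_def t_def by (rule qint_pos; simp)+
  have "qint[4] > 0" by (rule qint_pos) auto
  moreover have q4: "qint[4] = s * (t - 1)"
    using qint_relations(2) by (simp add: s_def t_def algebra_simps)
  ultimately have t1: "t > 1" using s by (simp add: zero_less_mult_iff)
  have q6: "qint[6] = s * 2" by (simp add: s_def qint_6)
  have ss: "s * s = t + 1" "s * (s * x) = (t + 1) * x" for x
    using qint_relations(1) by (simp_all add: s_def t_def power2_eq_square flip: mult.assoc)
  have tt: "t * t = 2 * t + 2" "t * (t * x) = 2 * (t * x) + 2 * x" for x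
    using qint3_reduce by (simp_all add: t_def)
  have root: "sqrt y = x" if "x \<ge> 0" "x\<^sup>2 = y" for x y :: real
    using that by (rule real_sqrt_unique [rotated])
  have value_eqI: "E5_value a b c = E5_sign a b c * x" if "x \<ge> 0" "x\<^sup>2 = s * E5_weight a b c" for a b c x
    unfolding E5_value_def using root[OF that] by (simp add: s_def)
  note fold = s_def [symmetric] t_def [symmetric]
  note eval = E5_weight_values E5_sign_def power_mult_distrib power_divide
  show "E5_value 1 6 12 = sqrt (qint[2] * qint[3])"
    "E5_value 4 10 15 = sqrt (qint[2] * qint[3])"
    "E5_value 5 9 16 = sqrt (qint[2] * qint[3])"
    by (simp_all add: E5_value_def eval)
  have "E5_value a b c = E5_sign a b c * (s * sqrt (t * (s * (t - 1))))"
    if "E5_weight a b c = 5 * t + 4" for a b c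
    using that s t t1 by (intro value_eqI) (simp_all add: eval power2_eq_square algebra_simps ss tt)
  then show "E5_value 1 6 13 = qint[2] * sqrt (qint[3] * qint[4])"
    "E5_value 1 7 12 = qint[2] * sqrt (qint[3] * qint[4])"
    unfolding q4 by (simp_all add: eval fold)
  have "E5_value a b c = E5_sign a b c * (s * (t - 1) * sqrt t / sqrt s)"
    if "E5_weight a b c = 3 * t" for a b c
    using that s t t1 by (intro value_eqI) (simp_all add: eval power2_eq_square field_simps ss tt)
  then show "E5_value 1 7 13 = qint[4] * sqrt (qint[3]) / sqrt (qint[2])"
    "E5_value 3 7 14 = qint[4] * sqrt (qint[3]) / sqrt (qint[2])"
    "E5_value 3 8 13 = qint[4] * sqrt (qint[3]) / sqrt (qint[2])"
    "E5_value 3 8 17 = qint[4] * sqrt (qint[3]) / sqrt (qint[2])"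
    "E5_value 3 11 14 = qint[4] * sqrt (qint[3]) / sqrt (qint[2])"
    unfolding q4 by (simp_all add: eval fold)
  have "E5_value a b c = E5_sign a b c * (t * sqrt (s * (t - 1)))"
    if "E5_weight a b c = 4 * t + 2" for a b c
    using that s t t1 by (intro value_eqI) (simp_all add: eval power2_eq_square algebra_simps ss tt)
  then show "E5_value 2 7 15 = qint[3] * sqrt (qint[4])"
    "E5_value 2 9 13 = qint[3] * sqrt (qint[4])"
    "E5_value 4 7 14 = qint[3] * sqrt (qint[4])"
    "E5_value 5 8 13 = qint[3] * sqrt (qint[4])"
    unfolding q4 by (simp_all add: eval fold)
  have "E5_value a b c = E5_sign a b c * (s * (t - 1) * sqrt (t * (s * 2)) / s)"
    if "E5_weight a b c = 6 * t" for a b c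
    using that s t t1 by (intro value_eqI) (simp_all add: eval power2_eq_square field_simps ss tt)
  then show "E5_value 1 8 14 = qint[4] * sqrt (qint[3] * qint[6]) / qint[2]"
    unfolding q4 q6 by (simp_all add: eval fold)
  have "E5_value a b c = E5_sign a b c * (sqrt (t * (s * (t - 1)) * (s * 2)) / sqrt s)"
    if "E5_weight a b c = 2 * t + 4" for a b c
    using that s t t1 by (intro value_eqI) (simp_all add: eval power2_eq_square field_simps ss tt)
  then show "E5_value 1 7 14 = sqrt (qint[3] * qint[4] * qint[6]) / sqrt (qint[2])"
    "E5_value 1 8 13 = sqrt (qint[3] * qint[4] * qint[6]) / sqrt (qint[2])"
    unfolding q4 q6 by (simp_all add: eval fold)
  have "E5_value a b c = E5_sign a b c * (s * (t - 1) * sqrt s)"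
    if "E5_weight a b c = 3 * t + 3" for a b c
    using that s t t1 by (intro value_eqI) (simp_all add: eval power2_eq_square algebra_simps ss tt)
  then show "E5_value 2 6 12 = qint[4] * sqrt (qint[2])"
    "E5_value 2 7 13 = - (qint[4] * sqrt (qint[2]))"
    unfolding q4 by (simp_all add: eval fold)
  have "E5_value a b c = E5_sign a b c * (s * sqrt (s * (t - 1)))"
    if "E5_weight a b c = 2 * t + 1" for a b c
    using that s t t1 by (intro value_eqI) (simp_all add: eval power2_eq_square algebra_simps ss tt)
  then show "E5_value 2 6 13 = qint[2] * sqrt (qint[4])"
    "E5_value 2 7 12 = qint[2] * sqrt (qint[4])"
    unfolding q4 by (simp_all add: eval fold)
  have "E5_value a b c = E5_sign a b c * (s * (t - 1) * sqrt (s * 2))"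
    if "E5_weight a b c = 6 * t + 6" for a b c
    using that s t t1 by (intro value_eqI) (simp_all add: eval power2_eq_square algebra_simps ss tt)
  then show "E5_value 3 7 13 = - (qint[4] * sqrt (qint[6]))"
    unfolding q4 q6 by (simp_all add: eval fold)
  have "E5_value a b c = E5_sign a b c * (s * (t - 1) * sqrt (s * 2) / s)"
    if "E5_weight a b c = 6" for a b c
    using that s t t1 by (intro value_eqI) (simp_all add: eval power2_eq_square field_simps ss tt)
  then show "E5_value 3 8 14 = qint[4] * sqrt (qint[6]) / qint[2]"
    unfolding q4 q6 by (simp_all add: eval fold)
  have "E5_value a b c = E5_sign a b c * sqrt (t * (s * (t - 1)))"
    if "E5_weight a b c = t + 2" for a b c
    using that s t t1 by (intro value_eqI) (simp_all add: eval power2_eq_square algebra_simps ss tt)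
  then show "E5_value 4 7 15 = sqrt (qint[3] * qint[4])"
    "E5_value 5 9 13 = sqrt (qint[3] * qint[4])"
    unfolding q4 by (simp_all add: eval fold)
qed

theorem theorem13p1:
  shows "\<exists>W. E5.cell_system W \<and>
    cell W 1 6 12 = sqrt (qint[2] * qint[3]) \<and>
    cell W 4 10 15 = sqrt (qint[2] * qint[3]) \<and>
    cell W 5 9 16 = sqrt (qint[2] * qint[3]) \<and>
    cell W 1 6 13 = qint[2] * sqrt (qint[3] * qint[4]) \<and>
    cell W 1 7 12 = qint[2] * sqrt (qint[3] * qint[4]) \<and>
    cell W 1 7 13 = qint[4] * sqrt (qint[3]) / sqrt (qint[2]) \<and>
    cell W 3 7 14 = qint[4] * sqrt (qint[3]) / sqrt (qint[2]) \<and>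
    cell W 3 8 13 = qint[4] * sqrt (qint[3]) / sqrt (qint[2]) \<and>
    cell W 3 8 17 = qint[4] * sqrt (qint[3]) / sqrt (qint[2]) \<and>
    cell W 3 11 14 = qint[4] * sqrt (qint[3]) / sqrt (qint[2]) \<and>
    cell W 2 7 15 = qint[3] * sqrt (qint[4]) \<and>
    cell W 2 9 13 = qint[3] * sqrt (qint[4]) \<and>
    cell W 4 7 14 = qint[3] * sqrt (qint[4]) \<and>
    cell W 5 8 13 = qint[3] * sqrt (qint[4]) \<and>
    cell W 1 8 14 = qint[4] * sqrt (qint[3] * qint[6]) / qint[2] \<and>
    cell W 1 7 14 = sqrt (qint[3] * qint[4] * qint[6]) / sqrt (qint[2]) \<and>
    cell W 1 8 13 = sqrt (qint[3] * qint[4] * qint[6]) / sqrt (qint[2]) \<and>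
    cell W 2 6 12 = qint[4] * sqrt (qint[2]) \<and>
    cell W 2 6 13 = qint[2] * sqrt (qint[4]) \<and>
    cell W 2 7 12 = qint[2] * sqrt (qint[4]) \<and>
    cell W 2 7 13 = - (qint[4] * sqrt (qint[2])) \<and>
    cell W 3 7 13 = - (qint[4] * sqrt (qint[6])) \<and>
    cell W 3 8 14 = qint[4] * sqrt (qint[6]) / qint[2] \<and>
    cell W 4 7 15 = sqrt (qint[3] * qint[4]) \<and>
    cell W 5 9 13 = sqrt (qint[3] * qint[4]) \<and>
    (\<forall>W'. E5.cell_system W' \<longrightarrow> E5.equivalent W' W)"
proof -
  have "cell E5_W a b c \<noteq> 0" if "(a, b, c) \<in> E5_cells" for a b c
    using E5_weight_pos[OF that] qint_pos[of 2]
    by (simp add: cell_E5_W E5_value_def E5_sign_def)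
  then have "\<forall>W'. E5.cell_system W' \<longrightarrow> E5.equivalent W' E5_W"
    using E5_equivalent[OF _ E5_W_cell_system] by blast
  with E5_W_cell_system show ?thesis
    by (intro exI[of _ E5_W] conjI)
      (simp_all only: cell_E5_W E5_value_formulas of_real_mult of_real_divide of_real_minus)
qed

end
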